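(* Let $\star\in\{*,T\}$, let $P(s)=\sum_{j=0}^m s^jA_j$ with $A_j\in\mathbb{C}^{n,n}$ be $\star$-palindromic, and let $k=\lfloor\frac{m-1}{2}\rfloor$. Define, for $\gamma_0,\dots,\gamma_k\in[0,1]$, $$f(\gamma_0,\dots,\gamma_k)=\sum_{j=0}^k\Big((A_j^\star)^*A_j^\star+\gamma_j\big(A_j^*A_j-(A_j^\star)^*A_j^\star\big)\Big)\quad\text{if } m \text{ is odd},$$ $$f(\gamma_0,\dots,\gamma_k)=\sum_{j=0}^k\Big((A_j^\star)^*A_j^\star+\gamma_j\big(A_j^*A_j-(A_j^\star)^*A_j^\star+A_{m/2}^*A_{m/2}\big)\Big)\quad\text{if } m \text{ is even}.$$ Then the supremum $$\hat\lambda_{\min}=\sup_{\gamma_0,\dots,\gamma_k\in[0,1]}\lambda_{\min}\big(f(\gamma_0,\dots,\gamma_k)\big)$$ is attained for some $\hat\gamma_0,\dots,\hat\gamma_k\in[0,1]$. Furthermore, $$\delta_0^{\mathrm{Pal}_\star}(P(s))^2\ \ge\ 2\,\hat\lambda_{\min},$$ and equality holds in this inequality if $m\le 2$ or $\hat\lambda_{\min}$ is a simple eigenvalue of $f(\hat\gamma_0,\dots,\hat\gamma_k)$.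
   Context: $\mathbb{C}^{n,n}$ is the set of complex $n\times n$ matrices; $\star=*$ is conjugate transpose and $\star=T$ is transpose. $P(s)=\sum_{j=0}^m s^jA_j$ is $\star$-palindromic if $A_j=A_{m-j}^\star$ for $j=0,\dots,m$. $\|\cdot\|$ is the spectral norm and $\lambda_{\min}(H)$ is the smallest eigenvalue of a Hermitian matrix $H$. The structured distance to a common null space is $$\delta_0^{\mathrm{Pal}_\star}(P(s))=\inf\Big\{\sqrt{\textstyle\sum_{j=0}^m\|\Delta_j\|^2}\;:\;\Delta_0,\dots,\Delta_m\in\mathbb{C}^{n,n},\ \Delta_j=\Delta_{m-j}^\star\ (j=0,\dots,m),\ \bigcap_{j=0}^m\ker(A_j-\Delta_j)\neq\{0\}\Big\}.$$
   Formalization: For even m, f is corrected: the terms γ_j A_{m/2}^*A_{m/2} in the sum are replaced by one term (1/2)A_{m/2}^*A_{m/2} outside it; as stated the inequality fails, e.g. n=1, m=2, A_1=1, A_0=A_2=0, where 2λ̂=2 but the squared distance is at most 1. *)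

theory Defs
  imports "HOL-Analysis.Analysis" "HOL-Computational_Algebra.Polynomial"
begin

definition ctranspose :: "complex^'n^'m \<Rightarrow> complex^'m^'n" where
  "ctranspose M = (\<chi> i j. cnj (M $ j $ i))"

text \<open>The norm of \<^typ>\<open>complex^'n\<close> is the Euclidean one, so its operator norm is the spectral norm.\<close>

definition spectral_norm :: "complex^'n^'n \<Rightarrow> real" where
  "spectral_norm M = onorm (\<lambda>x. M *v x)"

definition mat_kernel :: "complex^'n^'n \<Rightarrow> (complex^'n) set" where
  "mat_kernel M = {x. M *v x = 0}"

definition is_eigenvalue :: "complex^'n^'n \<Rightarrow> complex \<Rightarrow> bool" where
  "is_eigenvalue M l \<longleftrightarrow> (\<exists>v. v \<noteq> 0 \<and> M *v v = l *s v)"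

definition charpoly :: "complex^'n^'n \<Rightarrow> complex poly" where
  "charpoly M = det (\<chi> i j. (if i = j then [:0, 1:] else 0) - [:M $ i $ j:])"

definition simple_eigenvalue :: "complex^'n^'n \<Rightarrow> complex \<Rightarrow> bool" where
  "simple_eigenvalue M l \<longleftrightarrow> order l (charpoly M) = 1"

text \<open>Meant for Hermitian matrices only, whose eigenvalues are all real.\<close>

definition lambda_min :: "complex^'n^'n \<Rightarrow> real" where
  "lambda_min H = Min {r. is_eigenvalue H (complex_of_real r)}"

text \<open>A matrix polynomial of grade \<open>m\<close> is given by its coefficients \<open>A 0, \<dots>, A m\<close>; the leading
  one may vanish, and the values of \<open>A\<close> beyond \<open>m\<close> are irrelevant. The parameter \<open>star\<close> is the
  operation on square matrices, \<^const>\<open>ctranspose\<close> or \<^const>\<open>transpose\<close>.\<close>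

definition palindromic ::
  "(complex^'n^'n \<Rightarrow> complex^'n^'n) \<Rightarrow> nat \<Rightarrow> (nat \<Rightarrow> complex^'n^'n) \<Rightarrow> bool" where
  "palindromic star m A \<longleftrightarrow> (\<forall>j\<le>m. A j = star (A (m - j)))"

definition delta0_pal ::
  "(complex^'n^'n \<Rightarrow> complex^'n^'n) \<Rightarrow> nat \<Rightarrow> (nat \<Rightarrow> complex^'n^'n) \<Rightarrow> real" where
  "delta0_pal star m A =
     Inf {sqrt (\<Sum>j\<le>m. (spectral_norm (\<Delta> j))\<^sup>2) | \<Delta> :: nat \<Rightarrow> complex^'n^'n.
            palindromic star m \<Delta> \<and> (\<Inter>j\<le>m. mat_kernel (A j - \<Delta> j)) \<noteq> {0}}"

text \<open>The indices \<open>0, \<dots>, k\<close> with \<open>k = \<lfloor>(m - 1) / 2\<rfloor>\<close>; there are none for \<open>m = 0\<close>, where \<open>k = -1\<close>.\<close>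

definition pal_idx :: "nat \<Rightarrow> nat set" where
  "pal_idx m = {j. int j \<le> \<lfloor>(real m - 1) / 2\<rfloor>}"

text \<open>The cube of all tuples \<open>(\<gamma>\<^sub>0, \<dots>, \<gamma>\<^sub>k)\<close> in \<open>[0, 1]\<close>.\<close>

definition pal_cube :: "nat \<Rightarrow> (nat \<Rightarrow> real) set" where
  "pal_cube m = pal_idx m \<rightarrow>\<^sub>E {0..1}"

text \<open>For even \<open>m\<close> the middle coefficient occurs once in the sum defining the distance, while the
  coefficients with index \<open>j \<le> k\<close> are paired with those of index \<open>m - j\<close>. So twice the smallest
  eigenvalue has to count it with weight one half, independently of \<open>\<gamma>\<close>. A summand
  \<open>\<gamma> j *\<^sub>R (ctranspose (A (m div 2)) ** A (m div 2))\<close> for each \<open>j\<close> does not give a lower bound; see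
  \<open>gamma_weighted_middle_term_fails\<close> below.\<close>

definition pal_f ::
  "(complex^'n^'n \<Rightarrow> complex^'n^'n) \<Rightarrow> nat \<Rightarrow> (nat \<Rightarrow> complex^'n^'n) \<Rightarrow> (nat \<Rightarrow> real) \<Rightarrow> complex^'n^'n" where
  "pal_f star m A \<gamma> =
     (\<Sum>j\<in>pal_idx m. ctranspose (star (A j)) ** star (A j)
        + \<gamma> j *\<^sub>R (ctranspose (A j) ** A j - ctranspose (star (A j)) ** star (A j)))
     + (if even m then (1 / 2) *\<^sub>R (ctranspose (A (m div 2)) ** A (m div 2)) else 0)"

definition lambda_hat ::
  "(complex^'n^'n \<Rightarrow> complex^'n^'n) \<Rightarrow> nat \<Rightarrow> (nat \<Rightarrow> complex^'n^'n) \<Rightarrow> real" where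
  "lambda_hat star m A = (SUP \<gamma>\<in>pal_cube m. lambda_min (pal_f star m A \<gamma>))"

lemma lambda_min_scaleR_mat: "lambda_min (c *\<^sub>R mat 1 :: complex^'n^'n) = c"
proof -
  have *: "(c *\<^sub>R mat 1 :: complex^'n^'n) *v v = complex_of_real c *s v" for v
  proof -
    have "(\<Sum>j\<in>UNIV. (c *\<^sub>R mat 1 :: complex^'n^'n) $ i $ j * v $ j)
        = (\<Sum>j\<in>UNIV. if j = i then complex_of_real c * v $ j else 0)" for i
      by (rule sum.cong) (auto simp: mat_def scaleR_conv_of_real[where 'a = complex])
    then show ?thesis
      by (simp add: matrix_vector_mult_def vec_eq_iff)
  qed
  have ex: "\<exists>v::complex^'n. v \<noteq> 0"
    by (rule exI[of _ "axis undefined 1"]) (simp add: axis_eq_0_iff)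
  have "{r. is_eigenvalue (c *\<^sub>R mat 1 :: complex^'n^'n) (complex_of_real r)} = {c}"
    unfolding is_eigenvalue_def * using ex by (auto simp: vector_mul_rcancel)
  then show ?thesis
    unfolding lambda_min_def by simp
qed

lemma gamma_weighted_middle_term_fails:
  defines "A \<equiv> (\<lambda>j::nat. if j = 1 then mat 1 else 0 :: complex^'n^'n)"
  defines "f \<equiv> (\<lambda>\<gamma>::nat \<Rightarrow> real. \<Sum>j\<in>pal_idx 2. ctranspose (ctranspose (A j)) ** ctranspose (A j)
        + \<gamma> j *\<^sub>R (ctranspose (A j) ** A j - ctranspose (ctranspose (A j)) ** ctranspose (A j)
                    + ctranspose (A 1) ** A 1))"
  shows "palindromic ctranspose 2 A"
    and "(delta0_pal ctranspose 2 A)\<^sup>2 < 2 * (SUP \<gamma>\<in>pal_cube 2. lambda_min (f \<gamma>))"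
proof -
  have ct: "ctranspose (mat 1 :: complex^'n^'n) = mat 1" "ctranspose (0 :: complex^'n^'n) = 0"
    by (auto simp: ctranspose_def mat_def vec_eq_iff)
  show pal: "palindromic ctranspose 2 A"
    by (auto simp: palindromic_def A_def ct)
  have idx: "pal_idx 2 = {0}"
    by (auto simp: pal_idx_def)
  have "f \<gamma> = \<gamma> 0 *\<^sub>R mat 1" for \<gamma>
    by (simp add: f_def A_def idx ct)
  then have lm: "lambda_min (f \<gamma>) = \<gamma> 0" for \<gamma>
    by (simp add: lambda_min_scaleR_mat)
  have le1: "\<gamma> 0 \<le> 1" if "\<gamma> \<in> pal_cube 2" for \<gamma>
    using that by (auto simp: pal_cube_def idx dest!: PiE_mem)
  have mem: "(\<lambda>j\<in>{0}. 1) \<in> pal_cube 2"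
    by (auto simp: pal_cube_def idx)
  have "(\<lambda>j\<in>{0::nat}. 1::real) 0 \<le> (SUP \<gamma>\<in>pal_cube 2. \<gamma> 0)"
    by (rule cSUP_upper[OF mem]) (use le1 in \<open>auto simp: bdd_above_def\<close>)
  then have sup: "1 \<le> (SUP \<gamma>\<in>pal_cube 2. lambda_min (f \<gamma>))"
    by (simp add: lm)
  let ?S = "{sqrt (\<Sum>j\<le>2. (spectral_norm (\<Delta> j))\<^sup>2) | \<Delta> :: nat \<Rightarrow> complex^'n^'n.
            palindromic ctranspose 2 \<Delta> \<and> (\<Inter>j\<le>2. mat_kernel (A j - \<Delta> j)) \<noteq> {0}}"
  have "(axis undefined 1 :: complex^'n) \<noteq> 0"
    by (simp add: axis_eq_0_iff)
  then have "(\<Inter>j\<le>2::nat. mat_kernel (A j - A j)) \<noteq> {0}"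
    by (auto simp: mat_kernel_def)
  then have inS: "sqrt (\<Sum>j\<le>2. (spectral_norm (A j))\<^sup>2) \<in> ?S"
    using pal by blast
  have n1: "spectral_norm (mat 1 :: complex^'n^'n) = 1" "spectral_norm (0 :: complex^'n^'n) = 0"
    using onorm_id[where 'a = "complex^'n"] by (auto simp: spectral_norm_def id_def onorm_zero)
  have "sqrt (\<Sum>j\<le>2. (spectral_norm (A j))\<^sup>2) = 1"
    by (simp add: A_def n1 numeral_2_eq_2)
  with inS have "1 \<in> ?S" by simp
  moreover have nn: "\<forall>s\<in>?S. 0 \<le> s"
    by (auto intro!: sum_nonneg)
  ultimately have "Inf ?S \<le> 1" "0 \<le> Inf ?S"
    by (auto intro!: cInf_lower cInf_greatest simp: bdd_below_def) blast+
  then have "(delta0_pal ctranspose 2 A)\<^sup>2 \<le> 1"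
    unfolding delta0_pal_def by (simp add: power_le_one)
  with sup show "(delta0_pal ctranspose 2 A)\<^sup>2 < 2 * (SUP \<gamma>\<in>pal_cube 2. lambda_min (f \<gamma>))"
    by simp
qed

end

theory Submission
  imports Defs
begin

text \<open>Fix a unit vector \<open>x\<close>. A palindromic perturbation \<open>\<Delta>\<close> puts \<open>x\<close> in the common kernel iff
  \<open>\<Delta> j\<close> agrees with \<open>A j\<close> at \<open>x\<close> for all \<open>j\<close>. Since \<open>\<Delta> (m - j)\<close> is \<open>star (\<Delta> j)\<close>, this prescribes for each
  pair \<open>j, m - j\<close> the images of \<open>x\<close> under one matrix and under its \<open>star\<close>. Both images are lower bounds
  for the norm of that matrix, and a completion of Parrott type attains the larger one
  (\<open>minimal_norm_completion\<close>); a middle coefficient contributes \<open>|A (m/2) x|\<^sup>2\<close>. So the squared distance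
  is the minimum over unit vectors of \<open>perturbation_cost\<close>, a sum of maxima of two squared norms.

  A maximum of two numbers is the maximum of their convex combinations, so the cost at \<open>x\<close> is
  \<open>2 max\<^sub>\<gamma> (x, f(\<gamma>) x)\<close>. With the smallest eigenvalue as minimum of the form, the claim compares
  \<open>min\<^sub>x max\<^sub>\<gamma>\<close> with \<open>max\<^sub>\<gamma> min\<^sub>x\<close>: the inequality always holds, and equality holds once there is a
  saddle point, that is, an eigenvector for \<open>\<lambda>\<^sub>m\<^sub>i\<^sub>n (f(\<gamma>))\<close> at an optimal \<open>\<gamma>\<close> where each derivative of
  the form in \<open>\<gamma>\<^sub>j\<close> has the sign that optimality over \<open>[0, 1]\<close> asks for (\<open>delta0_pal_eq_if_saddle\<close>).

  Optimality of \<open>\<gamma>\<close> yields an eigenvector for each single sign condition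
  (\<open>optimal_coordinate_direction\<close>). If the eigenvalue is simple, all these eigenvectors are the same up
  to a phase, so they satisfy all conditions at once. If \<open>m \<le> 2\<close>, there is at most one parameter and so
  at most two conditions, \<open>\<le> 0\<close> and \<open>\<ge> 0\<close> for one quadratic form on the eigenspace; a common solution
  is a zero between the two eigenvectors.

  The vector space is treated as a real Euclidean space: the real inner product is the real part of
  the Hermitian one, and Hermitian matrices are self-adjoint for it.\<close>

section \<open>The Hermitian inner product and the two adjoints\<close>

definition cinner :: "complex^'n \<Rightarrow> complex^'n \<Rightarrow> complex" where
  "cinner x y = (\<Sum>i\<in>UNIV. cnj (x $ i) * y $ i)"

lemma inner_eq_Re_cinner: "x \<bullet> y = Re (cinner x y)"
  by (simp add: cinner_def inner_vec_def inner_complex_def)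

lemma cinner_commute: "cinner y x = cnj (cinner x y)"
  by (simp add: cinner_def mult.commute)

lemma cinner_diff_right: "cinner x (y - z) = cinner x y - cinner x z"
  by (simp add: cinner_def algebra_simps sum_subtractf)

lemma cinner_scale_right: "cinner x (c *s y) = c * cinner x y"
  by (simp add: cinner_def sum_distrib_left mult_ac)

lemma cinner_diff_left: "cinner (x - y) z = cinner x z - cinner y z"
  by (simp add: cinner_def algebra_simps sum_subtractf)

lemma cinner_scale_left: "cinner (c *s x) y = cnj c * cinner x y"
  by (simp add: cinner_def sum_distrib_left mult_ac)

lemmas cinner_simps =
  cinner_diff_right cinner_scale_right
  cinner_diff_left cinner_scale_left

lemma cinner_self: "cinner x x = complex_of_real ((norm x)\<^sup>2)"
proof -
  have "Im (cinner x x) = 0"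
    by (simp add: cinner_def)
  then show ?thesis
    by (simp add: complex_eq_iff power2_norm_eq_inner inner_eq_Re_cinner)
qed

lemma norm_vector_scale: "norm (c *s x :: complex^'n) = cmod c * norm x"
proof -
  have "complex_of_real ((norm (c *s x))\<^sup>2) = complex_of_real ((cmod c * norm x)\<^sup>2)"
    by (simp only: cinner_self[symmetric] cinner_scale_left cinner_scale_right)
      (simp add: cinner_self power_mult_distrib complex_norm_square[symmetric] flip: mult.assoc)
  then have "(norm (c *s x))\<^sup>2 = (cmod c * norm x)\<^sup>2"
    by (simp only: of_real_eq_iff)
  then show ?thesis
    by (simp add: power2_eq_iff_nonneg)
qed

lemma of_real_scale: "complex_of_real r *s v = r *\<^sub>R v"
  by (simp add: vec_eq_iff scaleR_conv_of_real[where 'a = complex])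

lemma scaleR_matrix_vector: "(r *\<^sub>R M) *v x = r *\<^sub>R (M *v x :: complex^'n)"
  by (simp add: matrix_vector_mult_def vec_eq_iff scaleR_sum_right)

lemma norm_add_orthogonal_sq:
  assumes "cinner x y = 0"
  shows "(norm (x + y))\<^sup>2 = (norm x)\<^sup>2 + (norm y)\<^sup>2"
  using assms
  by (simp add: power2_norm_eq_inner inner_add_left inner_add_right inner_commute[of y x]
      inner_eq_Re_cinner[of x y])

lemma cinner_Cauchy_Schwarz: "cmod (cinner x y) \<le> norm x * norm y"
proof (cases "cinner x y = 0")
  case False
  define c where "c = cnj (sgn (cinner x y))"
  have c: "cmod c = 1"
    using False by (simp add: c_def norm_sgn)
  have "c * cinner x y = complex_of_real (cmod (cinner x y))"
    using False
    by (simp add: c_def sgn_div_norm scaleR_conv_of_real divide_simps mult.commute[of _ "cinner x y"]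
        complex_norm_square[symmetric] power2_eq_square)
  then have "cmod (cinner x y) = x \<bullet> (c *s y)"
    by (simp add: inner_eq_Re_cinner cinner_scale_right)
  also have "\<dots> \<le> norm x * norm (c *s y)"
    by (rule norm_cauchy_schwarz)
  finally show ?thesis
    by (simp add: norm_vector_scale c)
qed simp

lemma cinner_ctranspose: "cinner (ctranspose M *v x) y = cinner x (M *v y)"
proof -
  have "cinner (ctranspose M *v x) y = (\<Sum>i\<in>UNIV. \<Sum>j\<in>UNIV. M $ j $ i * cnj (x $ j) * y $ i)"
    by (simp add: cinner_def ctranspose_def matrix_vector_mult_def sum_distrib_right)
  also have "\<dots> = (\<Sum>j\<in>UNIV. \<Sum>i\<in>UNIV. M $ j $ i * cnj (x $ j) * y $ i)"
    by (rule sum.swap)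
  also have "\<dots> = cinner x (M *v y)"
    by (simp add: cinner_def matrix_vector_mult_def sum_distrib_left mult_ac)
  finally show ?thesis .
qed

lemma inner_ctranspose: "(ctranspose M *v x) \<bullet> y = x \<bullet> (M *v y)"
  by (simp add: inner_eq_Re_cinner cinner_ctranspose)

lemma ctranspose_ctranspose [simp]: "ctranspose (ctranspose M) = M"
  by (simp add: ctranspose_def vec_eq_iff)

definition cnj_vec :: "complex^'n \<Rightarrow> complex^'n" where
  "cnj_vec x = (\<chi> i. cnj (x $ i))"

text \<open>The transpose is the conjugate transpose seen through an isometric involution of the
  vectors. So norms and completions for both readings of \<open>star\<close> reduce to the conjugate
  transpose.\<close>

lemma star_conjugation:
  fixes star :: "complex^'n^'n \<Rightarrow> complex^'n^'n"
  assumes "star \<in> {ctranspose, transpose}"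
  obtains \<sigma> where "\<And>x. \<sigma> (\<sigma> x) = x" "\<And>x. norm (\<sigma> x) = norm x"
    "\<And>M x. star M *v x = \<sigma> (ctranspose M *v \<sigma> x)"
proof (cases "star = ctranspose")
  case True
  then show ?thesis
    by (intro that[of "\<lambda>x. x"]) auto
next
  case False
  with assms have star: "star = transpose"
    by simp
  show ?thesis
  proof (rule that[of cnj_vec])
    show "cnj_vec (cnj_vec x) = x" for x :: "complex^'n"
      by (simp add: cnj_vec_def vec_eq_iff)
    show "norm (cnj_vec x) = norm x" for x :: "complex^'n"
      by (simp add: cnj_vec_def norm_vec_def)
    show "star M *v x = cnj_vec (ctranspose M *v cnj_vec x)" for M x
      by (simp add: star cnj_vec_def vec_eq_iff transpose_def ctranspose_def matrix_vector_mult_def)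
  qed
qed

lemma star_star:
  assumes "star \<in> {ctranspose, transpose}"
  shows "star (star M) = M"
  using assms by (auto simp: transpose_transpose)

lemma star_add:
  assumes "star \<in> {ctranspose, transpose}"
  shows "star (M + N) = star M + star N"
  using assms by (auto simp: ctranspose_def transpose_def vec_eq_iff)

lemma star_scaleR:
  assumes "star \<in> {ctranspose, transpose}"
  shows "star (r *\<^sub>R M) = r *\<^sub>R star M"
  using assms by (auto simp: ctranspose_def transpose_def vec_eq_iff)

section \<open>The spectral norm\<close>

lemma norm_matrix_vector_le: "norm (M *v x) \<le> spectral_norm M * norm x"
  unfolding spectral_norm_def by (rule onorm) simp

lemma spectral_norm_nonneg: "0 \<le> spectral_norm M"
  unfolding spectral_norm_def by (rule onorm_pos_le) simp

lemma spectral_norm_leI: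
  assumes "0 \<le> b" "\<And>x. norm (M *v x) \<le> b * norm x"
  shows "spectral_norm M \<le> b"
  unfolding spectral_norm_def using assms by (intro onorm_bound)

lemma spectral_norm_ctranspose_le:
  fixes M :: "complex^'n^'n"
  shows "spectral_norm (ctranspose M) \<le> spectral_norm M"
proof (rule spectral_norm_leI)
  fix x :: "complex^'n"
  let ?y = "ctranspose M *v x"
  have "norm ?y * norm ?y = x \<bullet> (M *v ?y)"
    by (simp flip: inner_ctranspose power2_norm_eq_inner power2_eq_square)
  also have "\<dots> \<le> norm x * (spectral_norm M * norm ?y)"
    by (rule order_trans[OF norm_cauchy_schwarz])
      (intro mult_left_mono norm_matrix_vector_le norm_ge_zero)
  finally have "norm ?y * norm ?y \<le> (spectral_norm M * norm x) * norm ?y"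
    by (simp add: mult_ac)
  then show "norm ?y \<le> spectral_norm M * norm x"
    using spectral_norm_nonneg[of M] by (cases "?y = 0") auto
qed (rule spectral_norm_nonneg)

lemma spectral_norm_star:
  assumes star: "star \<in> {ctranspose, transpose}"
  shows "spectral_norm (star M) = spectral_norm M"
proof -
  obtain \<sigma> where \<sigma>: "\<And>x. norm (\<sigma> x) = norm x" "\<And>M x. star M *v x = \<sigma> (ctranspose M *v \<sigma> x)"
    using star by (rule star_conjugation) blast
  have le: "spectral_norm (star N) \<le> spectral_norm N" for N
  proof (rule spectral_norm_leI)
    fix x
    have "norm (star N *v x) \<le> spectral_norm (ctranspose N) * norm x"
      using norm_matrix_vector_le[of "ctranspose N" "\<sigma> x"] by (simp add: \<sigma>)
    also have "\<dots> \<le> spectral_norm N * norm x"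
      by (intro mult_right_mono spectral_norm_ctranspose_le norm_ge_zero)
    finally show "norm (star N *v x) \<le> spectral_norm N * norm x" .
  qed (rule spectral_norm_nonneg)
  from le[of M] le[of "star M"] show ?thesis
    by (simp add: star_star[OF star])
qed

section \<open>Matrices of minimal norm with prescribed action and adjoint action\<close>

text \<open>This is the completion theorem of Parrott for one row and one column: relative to the
  orthogonal splittings \<open>span x \<oplus> x\<^sup>\<bottom>\<close> and \<open>span u \<oplus> u\<^sup>\<bottom>\<close> the first column and the first row of the
  matrix are given. With \<open>a\<close> the common corner, \<open>s\<close> and \<open>r\<close> the rests of the column and the row,
  and \<open>\<mu>\<close> the larger norm of the two, the block to fill in is \<open>- (a\<^sup>* / (\<mu>\<^sup>2 - |a|\<^sup>2)) s r\<^sup>*\<close>.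
  It makes the identity \<open>id\<close> in the proof available, in which the mixed terms cancel.\<close>

lemma minimal_norm_completion:
  fixes A :: "complex^'n^'n"
  assumes x: "norm x = 1" and u: "norm u = 1"
  obtains D where "D *v x = A *v x" "ctranspose D *v u = ctranspose A *v u"
    "spectral_norm D \<le> max (norm (A *v x)) (norm (ctranspose A *v u))"
proof -
  define \<mu> where "\<mu> = max (norm (A *v x)) (norm (ctranspose A *v u))"
  define a where "a = cinner u (A *v x)"
  define s where "s = A *v x - a *s u"
  define r where "r = ctranspose A *v u - cnj a *s x"
  define d where "d = \<mu>\<^sup>2 - (cmod a)\<^sup>2"
  define e where "e = complex_of_real (1 / d)"
  define D :: "complex^'n^'n" where
    "D = (\<chi> i j. u $ i * (a * cnj (x $ j) + cnj (r $ j)) + s $ i * (cnj (x $ j) - cnj a * e * cnj (r $ j)))"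
  have xx: "cinner x x = 1" and uu: "cinner u u = 1"
    using x u by (simp_all add: cinner_self)
  have a': "cinner (ctranspose A *v u) x = a"
    by (simp add: a_def cinner_ctranspose)
  have us: "cinner u s = 0"
    by (simp add: s_def cinner_simps uu a_def)
  then have su: "cinner s u = 0"
    by (metis cinner_commute complex_cnj_zero)
  have rx: "cinner r x = 0"
    by (simp add: r_def cinner_simps xx a')
  then have xr: "cinner x r = 0"
    by (metis cinner_commute complex_cnj_zero)
  have Dv: "D *v y = (a * cinner x y + cinner r y) *s u + (cinner x y - cnj a * (e * cinner r y)) *s s" for y
    by (simp add: D_def vec_eq_iff matrix_vector_mult_def cinner_def sum.distrib sum_subtractf
        sum_distrib_left sum_distrib_right algebra_simps)
  have Dc: "ctranspose D *v v = cinner u v *s (cnj a *s x + r) + cinner s v *s (x - (a * e) *s r)" for v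
    by (simp add: D_def vec_eq_iff matrix_vector_mult_def ctranspose_def cinner_def sum.distrib sum_subtractf
        sum_distrib_left sum_distrib_right algebra_simps e_def)
  have 1: "D *v x = A *v x"
    by (simp add: Dv xx rx s_def)
  have 2: "ctranspose D *v u = ctranspose A *v u"
    by (simp add: Dc uu su r_def)
  have "(norm (a *s u + s))\<^sup>2 = (cmod a)\<^sup>2 + (norm s)\<^sup>2"
    by (subst norm_add_orthogonal_sq) (simp_all add: cinner_simps us norm_vector_scale u)
  then have s_le: "(norm s)\<^sup>2 \<le> d"
    using power_mono[of "norm (A *v x)" \<mu> 2] by (simp add: s_def d_def \<mu>_def)
  have "(norm (cnj a *s x + r))\<^sup>2 = (cmod a)\<^sup>2 + (norm r)\<^sup>2"
    by (subst norm_add_orthogonal_sq) (simp_all add: cinner_simps xr norm_vector_scale x)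
  then have r_le: "(norm r)\<^sup>2 \<le> d"
    using power_mono[of "norm (ctranspose A *v u)" \<mu> 2] by (simp add: r_def d_def \<mu>_def)
  have d0: "0 \<le> d"
    using s_le by (meson order_trans zero_le_power2)
  have \<mu>0: "0 \<le> \<mu>"
    by (simp add: \<mu>_def le_max_iff_disj)
  have 3: "norm (D *v y) \<le> \<mu> * norm y" for y
  proof -
    define \<alpha> where "\<alpha> = cinner x y"
    define t where "t = e * cinner r y"
    have dt: "cinner r y = d * t"
    proof (cases "d = 0")
      case True
      with r_le show ?thesis
        by (simp add: cinner_def)
    qed (simp add: t_def e_def)
    have Bessel: "(cmod \<alpha>)\<^sup>2 + d * (cmod t)\<^sup>2 \<le> (norm y)\<^sup>2"
    proof -
      define w where "w = y - \<alpha> *s x"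
      have "cinner x w = 0"
        by (simp add: w_def cinner_simps xx \<alpha>_def)
      then have "(norm (\<alpha> *s x + w))\<^sup>2 = (cmod \<alpha>)\<^sup>2 + (norm w)\<^sup>2"
        by (subst norm_add_orthogonal_sq) (simp_all add: cinner_simps norm_vector_scale x)
      then have w: "(norm y)\<^sup>2 = (cmod \<alpha>)\<^sup>2 + (norm w)\<^sup>2"
        by (simp add: w_def)
      have "cinner r w = d * t"
        by (simp add: w_def cinner_simps rx dt)
      then have "d * cmod t \<le> norm r * norm w"
        using cinner_Cauchy_Schwarz[of r w] d0 by (simp add: norm_mult)
      then have "(d * cmod t)\<^sup>2 \<le> (norm r)\<^sup>2 * (norm w)\<^sup>2"
        using power_mono[of "d * cmod t" "norm r * norm w" 2] d0 by (simp add: power_mult_distrib)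
      also have "\<dots> \<le> d * (norm w)\<^sup>2"
        using r_le by (intro mult_right_mono) auto
      finally have "d * (d * (cmod t)\<^sup>2) \<le> d * (norm w)\<^sup>2"
        by (simp add: power2_eq_square mult_ac)
      then have "d * (cmod t)\<^sup>2 \<le> (norm w)\<^sup>2"
        using d0 by (cases "d = 0") auto
      with w show ?thesis
        by simp
    qed
    have id: "(cmod (a * \<alpha> + d * t))\<^sup>2 + d * (cmod (\<alpha> - cnj a * t))\<^sup>2
        = ((cmod a)\<^sup>2 + d) * ((cmod \<alpha>)\<^sup>2 + d * (cmod t)\<^sup>2)"
      by (simp only: cmod_power2) (simp add: power2_eq_square algebra_simps)
    have "(norm (p *s u + q *s s))\<^sup>2 = (cmod p)\<^sup>2 + (cmod q)\<^sup>2 * (norm s)\<^sup>2" for p q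
      by (subst norm_add_orthogonal_sq)
        (simp_all add: cinner_simps us norm_vector_scale u power_mult_distrib)
    then have "(norm (D *v y))\<^sup>2 = (cmod (a * \<alpha> + d * t))\<^sup>2 + (cmod (\<alpha> - cnj a * t))\<^sup>2 * (norm s)\<^sup>2"
      unfolding Dv \<alpha>_def[symmetric] t_def[symmetric] unfolding dt .
    also have "\<dots> \<le> (cmod (a * \<alpha> + d * t))\<^sup>2 + (cmod (\<alpha> - cnj a * t))\<^sup>2 * d"
      using s_le by (intro add_left_mono mult_left_mono) auto
    also have "\<dots> = \<mu>\<^sup>2 * ((cmod \<alpha>)\<^sup>2 + d * (cmod t)\<^sup>2)"
      using id by (simp add: mult.commute d_def)
    also have "\<dots> \<le> \<mu>\<^sup>2 * (norm y)\<^sup>2"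
      using Bessel by (intro mult_left_mono) auto
    finally show ?thesis
      using \<mu>0 by (simp flip: power_mult_distrib add: power2_le_iff_abs_le abs_mult)
  qed
  from 1 2 spectral_norm_leI[OF \<mu>0 3] show ?thesis
    by (intro that[of D]) (simp_all add: \<mu>_def)
qed

lemma minimal_norm_completion_star:
  fixes A :: "complex^'n^'n"
  assumes star: "star \<in> {ctranspose, transpose}" and x: "norm x = 1"
  obtains D where "D *v x = A *v x" "star D *v x = star A *v x"
    "spectral_norm D \<le> max (norm (A *v x)) (norm (star A *v x))"
proof -
  obtain \<sigma> where \<sigma>: "\<And>x. norm (\<sigma> x) = norm x" "\<And>M x. star M *v x = \<sigma> (ctranspose M *v \<sigma> x)"
    using star by (rule star_conjugation) blast
  obtain D where "D *v x = A *v x" "ctranspose D *v \<sigma> x = ctranspose A *v \<sigma> x"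
    "spectral_norm D \<le> max (norm (A *v x)) (norm (ctranspose A *v \<sigma> x))"
    by (rule minimal_norm_completion[of x "\<sigma> x" A]) (use x \<sigma> in auto)
  then show ?thesis
    by (intro that[of D]) (simp_all add: \<sigma>)
qed

text \<open>Averaging a completion with its image under \<open>star\<close> keeps the action on \<open>x\<close> and does not
  increase the norm.\<close>

lemma minimal_norm_completion_self_star:
  fixes A :: "complex^'n^'n"
  assumes star: "star \<in> {ctranspose, transpose}" and x: "norm x = 1" and A: "star A = A"
  obtains D where "star D = D" "D *v x = A *v x" "spectral_norm D \<le> norm (A *v x)"
proof -
  obtain D where D: "D *v x = A *v x" "star D *v x = A *v x" "spectral_norm D \<le> norm (A *v x)"
    using minimal_norm_completion_star[OF star x, of A] A by auto
  define E where "E = (1/2) *\<^sub>R (D + star D)"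
  have E: "E *v y = (1/2) *\<^sub>R (D *v y + star D *v y)" for y
    by (simp only: E_def scaleR_matrix_vector matrix_vector_mult_add_rdistrib)
  show ?thesis
  proof
    show "star E = E"
      by (simp add: E_def star_scaleR[OF star] star_add[OF star] star_star[OF star] add.commute)
    show "E *v x = A *v x"
      by (simp add: E D flip: scaleR_2)
    have "norm (E *v y) \<le> norm (A *v x) * norm y" for y
    proof -
      have "norm (E *v y) \<le> (1/2) * (norm (D *v y) + norm (star D *v y))"
        unfolding E by (simp add: norm_triangle_ineq)
      also have "\<dots> \<le> (1/2) * (spectral_norm D * norm y + spectral_norm (star D) * norm y)"
        by (intro mult_left_mono add_mono norm_matrix_vector_le) simp
      also have "\<dots> = spectral_norm D * norm y"
        by (simp add: spectral_norm_star[OF star])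
      also have "\<dots> \<le> norm (A *v x) * norm y"
        using D(3) by (intro mult_right_mono) auto
      finally show ?thesis .
    qed
    then show "spectral_norm E \<le> norm (A *v x)"
      by (intro spectral_norm_leI) auto
  qed
qed

section \<open>The smallest eigenvalue as a minimum of the quadratic form\<close>

lemma is_eigenvalue_real_iff: "is_eigenvalue H (complex_of_real r) \<longleftrightarrow> (\<exists>v. v \<noteq> 0 \<and> H *v v = r *\<^sub>R v)"
  by (simp add: is_eigenvalue_def of_real_scale)

text \<open>Moving from a zero \<open>x\<close> of the form in the direction \<open>f x\<close> changes the form to first order by
  \<open>2 t |f x|\<^sup>2\<close>, which would make it negative for small \<open>t < 0\<close>.\<close>

lemma semidefinite_form_zero_imp_kernel:
  fixes f :: "'a::real_inner \<Rightarrow> 'a"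
  assumes "linear f" and sym: "\<And>x y. x \<bullet> f y = f x \<bullet> y"
    and pos: "\<And>x. 0 \<le> x \<bullet> f x" and zero: "x \<bullet> f x = 0"
  shows "f x = 0"
proof (rule ccontr)
  assume "f x \<noteq> 0"
  define y where "y = f x"
  define N where "N = y \<bullet> y"
  define c where "c = y \<bullet> f y"
  have N: "0 < N"
    using \<open>f x \<noteq> 0\<close> by (simp add: N_def y_def)
  have c: "0 \<le> c"
    by (simp add: c_def pos)
  have exp: "0 \<le> 2 * t * N + t\<^sup>2 * c" for t
  proof -
    have "x \<bullet> f y = N"
      by (simp add: sym N_def y_def)
    moreover have "y \<bullet> f x = N"
      by (simp add: N_def y_def)
    ultimately have "(x + t *\<^sub>R y) \<bullet> f (x + t *\<^sub>R y) = 2 * t * N + t\<^sup>2 * c"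
      using zero
      by (simp add: linear_add[OF \<open>linear f\<close>] linear_cmul[OF \<open>linear f\<close>] inner_add_left
          inner_add_right c_def power2_eq_square algebra_simps)
    with pos[of "x + t *\<^sub>R y"] show ?thesis
      by simp
  qed
  \<comment> \<open>the factor \<open>1 / (c + 1)\<close> lets the linear term win, also when \<open>c = 0\<close>\<close>
  have "2 * (- N / (c + 1)) * N + (- N / (c + 1))\<^sup>2 * c = - (N\<^sup>2 * (c + 2) / (c + 1)\<^sup>2)"
    using c by (simp add: divide_simps) (simp add: power2_eq_square algebra_simps)
  moreover have "0 < N\<^sup>2 * (c + 2) / (c + 1)\<^sup>2"
    using N c by (intro divide_pos_pos mult_pos_pos) auto
  ultimately show False
    using exp[of "- N / (c + 1)"] by linarith
qed

text \<open>The minimum in the definition is taken over a finite set, as eigenvectors of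
  different real eigenvalues are orthogonal.\<close>

lemma finite_real_eigenvalues:
  fixes H :: "complex^'n^'n"
  assumes sym: "\<And>x y. x \<bullet> (H *v y) = (H *v x) \<bullet> y"
  shows "finite {r. is_eigenvalue H (complex_of_real r)}"
proof -
  let ?E = "{r. is_eigenvalue H (complex_of_real r)}"
  have "\<forall>r\<in>?E. \<exists>v. v \<noteq> 0 \<and> H *v v = r *\<^sub>R v"
    by (simp add: is_eigenvalue_real_iff)
  from bchoice[OF this] obtain v where "\<forall>r\<in>?E. v r \<noteq> 0 \<and> H *v v r = r *\<^sub>R v r"
    by blast
  then have v: "\<And>r. r \<in> ?E \<Longrightarrow> v r \<noteq> 0 \<and> H *v v r = r *\<^sub>R v r"
    by blast
  have orth: "v r \<bullet> v s = 0" if "r \<in> ?E" "s \<in> ?E" "r \<noteq> s" for r s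
  proof -
    have "s * (v r \<bullet> v s) = r * (v r \<bullet> v s)"
      using sym[of "v r" "v s"] v[OF that(1)] v[OF that(2)] by simp
    with that(3) show ?thesis
      by simp
  qed
  have inj: "inj_on v ?E"
    by (rule inj_onI) (metis inner_eq_zero_iff orth v)
  have "pairwise orthogonal (v ` ?E)"
    by (auto simp: pairwise_def orthogonal_def intro!: orth)
  then have "independent (v ` ?E)"
    by (rule pairwise_orthogonal_independent) (use v in force)
  then have "finite (v ` ?E)"
    by (rule finiteI_independent)
  then show ?thesis
    using inj finite_image_iff by blast
qed

lemma lambda_min_self_adjoint:
  fixes H :: "complex^'n^'n"
  assumes sym: "\<And>x y. x \<bullet> (H *v y) = (H *v x) \<bullet> y"
  shows lambda_min_eigenvector: "\<exists>v. norm v = 1 \<and> H *v v = lambda_min H *\<^sub>R v"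
    and lambda_min_le_form: "lambda_min H * (norm x)\<^sup>2 \<le> x \<bullet> (H *v x)"
    and lambda_min_form_eqD: "x \<bullet> (H *v x) = lambda_min H * (norm x)\<^sup>2 \<Longrightarrow> H *v x = lambda_min H *\<^sub>R x"
proof -
  let ?E = "{r. is_eigenvalue H (complex_of_real r)}"
  have "continuous_on (sphere 0 1) (\<lambda>x. x \<bullet> (H *v x))"
    by (intro continuous_intros linear_continuous_on) (simp add: linear_linear)
  moreover have "sphere (0::complex^'n) 1 \<noteq> {}"
    by simp
  ultimately obtain x0 where x0: "norm x0 = 1"
    and min: "\<And>x. norm x = 1 \<Longrightarrow> x0 \<bullet> (H *v x0) \<le> x \<bullet> (H *v x)"
    using continuous_attains_inf[of "sphere (0::complex^'n) 1" "\<lambda>x. x \<bullet> (H *v x)"] by auto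
  define l where "l = x0 \<bullet> (H *v x0)"
  have le: "l * (norm x)\<^sup>2 \<le> x \<bullet> (H *v x)" for x
  proof (cases "x = 0")
    case False
    let ?u = "(1 / norm x) *\<^sub>R x"
    have "H *v ?u = (1 / norm x) *\<^sub>R (H *v x)"
      using linear_cmul[OF matrix_vector_mul_linear[of H]] by blast
    then have "?u \<bullet> (H *v ?u) = (x \<bullet> (H *v x)) / (norm x)\<^sup>2"
      by (simp add: power2_eq_square)
    then have "l \<le> (x \<bullet> (H *v x)) / (norm x)\<^sup>2"
      using min[of ?u] False by (simp add: l_def)
    with False show ?thesis
      by (simp add: pos_le_divide_eq)
  qed simp
  have ker: "H *v x = l *\<^sub>R x" if "x \<bullet> (H *v x) = l * (norm x)\<^sup>2" for x
  proof -
    have "linear (\<lambda>x. H *v x - l *\<^sub>R x)"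
      by (intro linear_compose_sub matrix_vector_mul_linear linear_scaleR)
    then have "H *v x - l *\<^sub>R x = 0"
      by (rule semidefinite_form_zero_imp_kernel)
        (use that le in \<open>auto simp: inner_diff_right inner_diff_left sym power2_norm_eq_inner\<close>)
    then show ?thesis
      by simp
  qed
  have eig0: "H *v x0 = l *\<^sub>R x0"
    by (rule ker) (simp add: x0 l_def)
  then have "l \<in> ?E"
    using x0 by (auto simp: is_eigenvalue_real_iff intro!: exI[of _ x0])
  moreover have "l \<le> r" if "r \<in> ?E" for r
  proof -
    obtain v where v: "v \<noteq> 0" "H *v v = r *\<^sub>R v"
      using \<open>r \<in> ?E\<close> by (auto simp: is_eigenvalue_real_iff)
    with le[of v] show ?thesis
      by (simp add: power2_norm_eq_inner)
  qed
  ultimately have l: "lambda_min H = l"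
    unfolding lambda_min_def by (intro Min_eqI finite_real_eigenvalues sym)
  show "\<exists>v. norm v = 1 \<and> H *v v = lambda_min H *\<^sub>R v"
    using x0 eig0 l by auto
  show "lambda_min H * (norm x)\<^sup>2 \<le> x \<bullet> (H *v x)"
    by (simp add: l le)
  show "H *v x = lambda_min H *\<^sub>R x" if "x \<bullet> (H *v x) = lambda_min H * (norm x)\<^sup>2"
    using that unfolding l by (rule ker)
qed

section \<open>Simple eigenvalues have one-dimensional eigenspaces\<close>

lemma poly_det: "poly (det P) z = det (\<chi> i j. poly (P $ i $ j) z)"
  for P :: "'a::comm_ring_1 poly^'n^'n"
  by (simp add: det_def poly_sum poly_prod)

lemma poly_charpoly: "poly (charpoly M) z = det (\<chi> i j. (if i = j then z else 0) - M $ i $ j)"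
  unfolding charpoly_def poly_det by (rule arg_cong[of _ _ det]) (auto simp: vec_eq_iff)

lemma charmatrix_mult_vec:
  fixes M :: "complex^'n^'n"
  shows "(\<chi> i j. (if i = j then z else 0) - M $ i $ j) *v w = z *s w - M *v w"
proof -
  have "(\<Sum>j\<in>UNIV. ((if i = j then z else 0) - M $ i $ j) * w $ j)
      = (\<Sum>j\<in>UNIV. (if i = j then z * w $ j else 0) - M $ i $ j * w $ j)" for i
    by (rule sum.cong) (auto simp: algebra_simps)
  then show ?thesis
    by (simp add: vec_eq_iff matrix_vector_mult_def sum_subtractf)
qed

lemma charpoly_nonzero:
  fixes M :: "complex^'n^'n"
  shows "charpoly M \<noteq> 0"
proof
  assume *: "charpoly M = 0"
  define z where "z = complex_of_real (spectral_norm M + 1)"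
  let ?C = "\<chi> i j. (if i = j then z else 0) - M $ i $ j"
  have "w = 0" if "?C *v w = 0" for w
  proof -
    have "norm (M *v w) = (spectral_norm M + 1) * norm w"
      using that spectral_norm_nonneg[of M]
      by (simp add: charmatrix_mult_vec z_def norm_vector_scale of_real_scale
          del: of_real_add flip: eq_iff_diff_eq_0)
        (metis abs_of_nonneg add_nonneg_nonneg norm_scaleR zero_le_one)
    then show "w = 0"
      using norm_matrix_vector_le[of M w] by (simp add: algebra_simps)
  qed
  then have "invertible ?C"
    unfolding invertible_left_inverse matrix_left_invertible_ker by blast
  then have "det ?C \<noteq> 0"
    by (simp add: invertible_det_nz)
  then have "poly (charpoly M) z \<noteq> 0"
    by (simp add: poly_charpoly)
  with * show False
    by simp
qed

lemma det_scale_two_columns: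
  fixes N :: "complex^'n^'n"
  assumes "a \<noteq> b"
  shows "det (\<chi> i j. if j \<in> {a, b} then t * N $ i $ j else N $ i $ j) = t\<^sup>2 * det N"
proof -
  let ?d = "\<lambda>j. if j \<in> {a, b} then t else 1"
  let ?D = "\<chi> i j. if i = j then ?d j else 0"
  have "(N ** ?D) $ i $ j = N $ i $ j * ?d j" for i j
    unfolding matrix_matrix_mult_def by (simp add: if_distrib cong: if_cong)
  then have "(\<chi> i j. if j \<in> {a, b} then t * N $ i $ j else N $ i $ j) = N ** ?D"
    by (auto simp: vec_eq_iff)
  moreover have "det ?D = (\<Prod>j\<in>UNIV. ?d j)"
    by (subst det_diagonal) auto
  moreover have "(\<Prod>j\<in>UNIV. ?d j) = (\<Prod>j\<in>{a, b}. t)"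
    by (rule prod.mono_neutral_cong_right) auto
  ultimately show ?thesis
    using assms by (simp add: det_mul power2_eq_square)
qed

text \<open>Given two eigenvectors that are not parallel, one can be reduced so that it vanishes at a
  coordinate \<open>a\<close> where the other one does not. Applying Cramer's rule to \<open>z I - M\<close> at \<open>a\<close>, and to the
  result at a coordinate \<open>b\<close> of the reduced vector, replaces two columns by multiples of \<open>z - l\<close>;
  so \<open>(z - l)\<^sup>2\<close> divides the characteristic polynomial.\<close>

lemma simple_eigenvalue_eigenvectors_parallel:
  fixes M :: "complex^'n^'n"
  assumes simple: "simple_eigenvalue M l"
    and u: "u \<noteq> 0" "M *v u = l *s u" and v: "M *v v = l *s v"
  shows "\<exists>c. v = c *s u"
proof -
  obtain a where a: "u $ a \<noteq> 0"
    using u by (auto simp: vec_eq_iff)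
  define w where "w = v - (v $ a / u $ a) *s u"
  have wa: "w $ a = 0"
    using a by (simp add: w_def)
  have Mw: "M *v w = l *s w"
    by (simp add: w_def matrix_vector_mult_diff_distrib vector_scalar_commute u v
        vector_ssub_ldistrib vector_smult_assoc mult.commute)
  have "w = 0"
  proof (rule ccontr)
    assume "w \<noteq> 0"
    then obtain b where b: "w $ b \<noteq> 0"
      by (auto simp: vec_eq_iff)
    have ab: "a \<noteq> b"
      using wa b by auto
    define P where "P = (\<chi> i j. if j = a then [:u $ i:] else if j = b then [:w $ i:]
      else (if i = j then [:0, 1:] else 0) - [:M $ i $ j:])"
    have "u $ a * w $ b * poly (charpoly M) z = (z - l)\<^sup>2 * poly (det P) z" for z
    proof -
      let ?C = "\<chi> i j. (if i = j then z else 0) - M $ i $ j"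
      let ?C1 = "\<chi> i j. if j = a then (?C *v u) $ i else ?C $ i $ j"
      let ?C2 = "\<chi> i j. if j = b then (?C1 *v w) $ i else ?C1 $ i $ j"
      let ?N = "\<chi> i j. poly (P $ i $ j) z"
      have "?C1 *v w = ?C *v w"
        unfolding matrix_vector_mult_def vec_eq_iff
        by (auto intro!: sum.cong simp: wa)
      then have "?C1 *v w = (z - l) *s w"
        by (simp add: charmatrix_mult_vec Mw vector_sub_rdistrib)
      moreover have "?C *v u = (z - l) *s u"
        by (simp add: charmatrix_mult_vec u vector_sub_rdistrib)
      ultimately have "?C2 = (\<chi> i j. if j \<in> {a, b} then (z - l) * ?N $ i $ j else ?N $ i $ j)"
        using ab by (auto simp: vec_eq_iff P_def left_diff_distrib)
      then have "det ?C2 = (z - l)\<^sup>2 * det ?N"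
        by (simp only: det_scale_two_columns[OF ab])
      moreover have "det ?C2 = w $ b * (u $ a * det ?C)"
        by (simp only: cramer_lemma)
      ultimately show ?thesis
        by (simp add: poly_charpoly poly_det mult_ac)
    qed
    then have "smult (u $ a * w $ b) (charpoly M) = [:- l, 1:]\<^sup>2 * det P"
      by (intro poly_ext) simp
    then have "[:- l, 1:]\<^sup>2 dvd charpoly M"
      using a b by (metis dvd_smult_iff dvd_triv_left mult_eq_0_iff)
    then have "2 \<le> order l (charpoly M)"
      using charpoly_nonzero[of M] by (simp add: order_divides)
    with simple show False
      by (simp add: simple_eigenvalue_def)
  qed
  then show ?thesis
    by (auto simp: w_def)
qed

section \<open>First-order optimality and sign changes of forms\<close>

text \<open>A one-sided derivative test for a minimum value: if adding small positive multiples of \<open>K\<close> to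
  \<open>F\<close> never lifts the minimum above the minimum \<open>L\<close> of \<open>F\<close>, then \<open>K\<close> is nonpositive at some
  minimizer of \<open>F\<close>, namely at any limit of minimizers of the perturbed functions.\<close>

lemma minimizer_of_unimproved_minimum:
  fixes F K :: "'a::metric_space \<Rightarrow> real"
  assumes S: "compact S" and cont: "continuous_on S F" "continuous_on S K" and e: "0 < e"
    and lower: "\<And>x. x \<in> S \<Longrightarrow> L \<le> F x"
    and upper: "\<And>t. 0 < t \<Longrightarrow> t \<le> e \<Longrightarrow> \<exists>x\<in>S. F x + t * K x \<le> L"
  shows "\<exists>x\<in>S. F x = L \<and> K x \<le> 0"
proof -
  define t where "t n = e / real (Suc n)" for n
  have t: "0 < t n" "t n \<le> e" for n
    using e by (auto simp: t_def divide_simps)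
  have "\<exists>x. x \<in> S \<and> F x + t n * K x \<le> L" for n
    using upper[OF t] by blast
  then obtain X where X: "\<And>n. X n \<in> S" "\<And>n. F (X n) + t n * K (X n) \<le> L"
    by metis
  obtain x r where x: "x \<in> S" and r: "strict_mono r" and lim: "(X \<circ> r) \<longlonglongrightarrow> x"
    using S X(1) unfolding compact_def by metis
  have F: "(\<lambda>n. F (X (r n))) \<longlonglongrightarrow> F x" and K: "(\<lambda>n. K (X (r n))) \<longlonglongrightarrow> K x"
    using continuous_on_tendsto_compose[OF cont(1) lim x] continuous_on_tendsto_compose[OF cont(2) lim x] X(1)
    by (auto simp: comp_def)
  have "t \<longlonglongrightarrow> 0"
    unfolding t_def using lim_const_over_n[of e] by (rule LIMSEQ_Suc)
  then have t0: "(\<lambda>n. t (r n)) \<longlonglongrightarrow> 0"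
    using LIMSEQ_subseq_LIMSEQ[OF _ r] by (auto simp: comp_def)
  have "(\<lambda>n. F (X (r n)) + t (r n) * K (X (r n))) \<longlonglongrightarrow> F x + 0 * K x"
    by (intro tendsto_intros F K t0)
  then have "F x + 0 * K x \<le> L"
    by (rule LIMSEQ_le_const2) (use X(2) in blast)
  moreover have "K (X n) \<le> 0" for n
  proof -
    have "t n * K (X n) \<le> 0"
      using X(2)[of n] lower[OF X(1)[of n]] by linarith
    then show ?thesis
      using t(1)[of n] by (simp add: mult_le_0_iff)
  qed
  then have "K x \<le> 0"
    using LIMSEQ_le_const2[OF K] by blast
  ultimately show ?thesis
    using x lower[OF x] by auto
qed

text \<open>On the segment from \<open>x\<close> to \<open>y\<close> the form has a zero. It can be normalized unless it is the
  origin, and then \<open>y = - x\<close>, so that the form has the same value at both ends.\<close>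

lemma quadratic_zero_in_subspace:
  fixes k :: "'a::real_normed_vector \<Rightarrow> real"
  assumes V: "subspace V" and x: "x \<in> V" "norm x = 1" "k x \<le> 0" and y: "y \<in> V" "norm y = 1" "0 \<le> k y"
    and cont: "continuous_on UNIV k" and hom: "\<And>c z. k (c *\<^sub>R z) = c\<^sup>2 * k z"
  shows "\<exists>z\<in>V. norm z = 1 \<and> k z = 0"
proof -
  define p where "p t = (1 - t) *\<^sub>R x + t *\<^sub>R y" for t :: real
  have "continuous_on {0..1} p"
    unfolding p_def by (intro continuous_intros)
  then have "continuous_on {0..1} (\<lambda>t. k (p t))"
    by (rule continuous_on_compose2[OF cont]) auto
  then have "\<exists>t. 0 \<le> t \<and> t \<le> 1 \<and> k (p t) = 0"
    by (intro IVT') (use x y in \<open>auto simp: p_def\<close>)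
  then obtain t where t: "0 \<le> t" "t \<le> 1" "k (p t) = 0"
    by blast
  show ?thesis
  proof (cases "p t = 0")
    case True
    then have eq: "(1 - t) *\<^sub>R x = (- t) *\<^sub>R y"
      by (simp add: p_def add_eq_0_iff)
    then have "norm ((1 - t) *\<^sub>R x) = norm ((- t) *\<^sub>R y)"
      by simp
    then have "t = 1 / 2"
      using t x y by simp
    with eq have "(1 / 2) *\<^sub>R x = (1 / 2) *\<^sub>R ((- 1) *\<^sub>R y)"
      by simp
    then have "x = (- 1) *\<^sub>R y"
      unfolding scaleR_cancel_left by simp
    then have "k x = k y"
      using hom[of "- 1" y] by simp
    with x y show ?thesis
      by (intro bexI[of _ x]) auto
  next
    case False
    have "(1 / norm (p t)) *\<^sub>R p t \<in> V"
      using V x y by (auto simp: p_def intro!: subspace_scale subspace_add)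
    then show ?thesis
      by (rule bexI[rotated]) (use False t in \<open>simp add: hom\<close>)
  qed
qed

section \<open>The distance as a minimum over unit vectors\<close>

lemma pal_idx_eq: "pal_idx m = {j. 2 * j < m}"
proof -
  have "int j \<le> \<lfloor>(real m - 1) / 2\<rfloor> \<longleftrightarrow> 2 * j < m" for j
    by (subst le_floor_iff) (auto simp: field_simps)
  then show ?thesis
    by (simp add: pal_idx_def)
qed

lemma finite_pal_idx [simp]: "finite (pal_idx m)"
  by (rule finite_subset[of _ "{..m}"]) (auto simp: pal_idx_eq)

lemma sum_palindrome:
  fixes g :: "nat \<Rightarrow> real"
  assumes "\<And>j. j \<le> m \<Longrightarrow> g (m - j) = g j"
  shows "(\<Sum>j\<le>m. g j) = 2 * (\<Sum>j\<in>pal_idx m. g j) + (if even m then g (m div 2) else 0)"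
proof -
  let ?I = "pal_idx m" and ?J = "(\<lambda>j. m - j) ` pal_idx m" and ?M = "if even m then {m div 2} else {}"
  have J: "?J = {j. j \<le> m \<and> m < 2 * j}"
  proof (intro subset_antisym subsetI)
    show "j \<in> ?J" if "j \<in> {j. j \<le> m \<and> m < 2 * j}" for j
      using that by (intro image_eqI[of _ _ "m - j"]) (auto simp: pal_idx_eq)
  qed (auto simp: pal_idx_eq)
  have "{..m} = ?I \<union> ?J \<union> ?M"
    unfolding J by (auto simp: pal_idx_eq elim!: evenE) presburger+
  moreover have "?I \<inter> ?J = {}" "(?I \<union> ?J) \<inter> ?M = {}"
    unfolding J by (auto simp: pal_idx_eq)
  ultimately have "(\<Sum>j\<le>m. g j) = (\<Sum>j\<in>?I. g j) + (\<Sum>j\<in>?J. g j) + (\<Sum>j\<in>?M. g j)"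
    by (simp add: sum.union_disjoint)
  moreover have "(\<Sum>j\<in>?J. g j) = (\<Sum>j\<in>?I. g j)"
    by (subst sum.reindex) (auto simp: pal_idx_eq inj_on_def assms intro!: sum.cong)
  ultimately show ?thesis
    by simp
qed

text \<open>For a unit vector \<open>x\<close> this is the least sum of squares of the norms of the coefficients of a
  palindromic perturbation that puts \<open>x\<close> in the common kernel: the perturbations of \<open>A j\<close> and
  \<open>A (m - j)\<close> have the same norm, which is bounded below by both \<open>norm (A j *v x)\<close> and
  \<open>norm (star (A j) *v x)\<close>, and the completions above attain the larger of the two.\<close>

definition perturbation_cost ::
  "(complex^'n^'n \<Rightarrow> complex^'n^'n) \<Rightarrow> nat \<Rightarrow> (nat \<Rightarrow> complex^'n^'n) \<Rightarrow> complex^'n \<Rightarrow> real" where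
  "perturbation_cost star m A x =
     2 * (\<Sum>j\<in>pal_idx m. max ((norm (A j *v x))\<^sup>2) ((norm (star (A j) *v x))\<^sup>2))
     + (if even m then (norm (A (m div 2) *v x))\<^sup>2 else 0)"

lemma palindromic_star:
  assumes "star \<in> {ctranspose, transpose}" "palindromic star m A" "j \<le> m"
  shows "A (m - j) = star (A j)"
  using assms star_star[OF assms(1)] by (metis palindromic_def)

lemma perturbation_cost_le:
  fixes \<Delta> :: "nat \<Rightarrow> complex^'n^'n"
  assumes star: "star \<in> {ctranspose, transpose}"
    and A: "palindromic star m A" and \<Delta>: "palindromic star m \<Delta>"
    and x: "norm x = 1" and ker: "\<And>j. j \<le> m \<Longrightarrow> \<Delta> j *v x = A j *v x"
  shows "perturbation_cost star m A x \<le> (\<Sum>j\<le>m. (spectral_norm (\<Delta> j))\<^sup>2)"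
proof -
  have norm_eq: "spectral_norm (\<Delta> (m - j)) = spectral_norm (\<Delta> j)" if "j \<le> m" for j
    by (simp add: palindromic_star[OF star \<Delta> that] spectral_norm_star[OF star])
  have le: "(norm (A j *v x))\<^sup>2 \<le> (spectral_norm (\<Delta> j))\<^sup>2" if "j \<le> m" for j
    using norm_matrix_vector_le[of "\<Delta> j" x] ker[OF that] x by (simp add: power_mono)
  have "(norm (star (A j) *v x))\<^sup>2 \<le> (spectral_norm (\<Delta> j))\<^sup>2" if "j \<le> m" for j
    using le[of "m - j"] by (simp add: norm_eq[OF that] palindromic_star[OF star A that])
  with le have "(\<Sum>j\<in>pal_idx m. max ((norm (A j *v x))\<^sup>2) ((norm (star (A j) *v x))\<^sup>2))
      \<le> (\<Sum>j\<in>pal_idx m. (spectral_norm (\<Delta> j))\<^sup>2)"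
    by (intro sum_mono) (auto simp: pal_idx_eq)
  moreover have "(\<Sum>j\<le>m. (spectral_norm (\<Delta> j))\<^sup>2) = 2 * (\<Sum>j\<in>pal_idx m. (spectral_norm (\<Delta> j))\<^sup>2)
      + (if even m then (spectral_norm (\<Delta> (m div 2)))\<^sup>2 else 0)"
    by (rule sum_palindrome) (simp add: norm_eq)
  ultimately show ?thesis
    using le[of "m div 2"] by (auto simp: perturbation_cost_def)
qed

lemma perturbation_cost_attained:
  fixes A :: "nat \<Rightarrow> complex^'n^'n"
  assumes star: "star \<in> {ctranspose, transpose}"
    and A: "palindromic star m A" and x: "norm x = 1"
  obtains \<Delta> where "palindromic star m \<Delta>" "\<And>j. j \<le> m \<Longrightarrow> \<Delta> j *v x = A j *v x"
    "(\<Sum>j\<le>m. (spectral_norm (\<Delta> j))\<^sup>2) \<le> perturbation_cost star m A x"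
proof -
  have "\<exists>D. D *v x = A j *v x \<and> star D *v x = star (A j) *v x
      \<and> spectral_norm D \<le> max (norm (A j *v x)) (norm (star (A j) *v x))" for j
    using minimal_norm_completion_star[OF star x, of "A j"] by metis
  then obtain D where D: "\<And>j. D j *v x = A j *v x" "\<And>j. star (D j) *v x = star (A j) *v x"
    "\<And>j. spectral_norm (D j) \<le> max (norm (A j *v x)) (norm (star (A j) *v x))"
    by metis
  have "\<exists>E. even m \<longrightarrow> star E = E \<and> E *v x = A (m div 2) *v x
      \<and> spectral_norm E \<le> norm (A (m div 2) *v x)"
  proof (cases "even m")
    case True
    have "star (A (m div 2)) = A (m div 2)"
      using palindromic_star[OF star A, of "m div 2"] True by (auto elim!: evenE)
    then show ?thesis
      using minimal_norm_completion_self_star[OF star x] by metis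
  qed simp
  then obtain E where E: "even m \<Longrightarrow> star E = E" "even m \<Longrightarrow> E *v x = A (m div 2) *v x"
    "even m \<Longrightarrow> spectral_norm E \<le> norm (A (m div 2) *v x)"
    by blast
  define \<Delta> where "\<Delta> j = (if 2 * j < m then D j else if 2 * j = m then E else star (D (m - j)))" for j
  have pal: "palindromic star m \<Delta>"
    unfolding palindromic_def \<Delta>_def using E(1) by (auto simp: star_star[OF star])
  have ker: "\<Delta> j *v x = A j *v x" if "j \<le> m" for j
  proof (cases "2 * j" m rule: linorder_cases)
    case less
    then show ?thesis
      by (simp add: \<Delta>_def D)
  next
    case equal
    then show ?thesis
      using E(2) by (auto simp: \<Delta>_def)
  next
    case greater
    moreover have "star (A (m - j)) = A j"
      using palindromic_star[OF star A, of "m - j"] that by simp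
    ultimately show ?thesis
      by (simp add: \<Delta>_def D)
  qed
  have norm_eq: "spectral_norm (\<Delta> (m - j)) = spectral_norm (\<Delta> j)" if "j \<le> m" for j
    by (simp add: palindromic_star[OF star pal that] spectral_norm_star[OF star])
  have "(spectral_norm (\<Delta> j))\<^sup>2 \<le> max ((norm (A j *v x))\<^sup>2) ((norm (star (A j) *v x))\<^sup>2)"
    if "j \<in> pal_idx m" for j
  proof -
    have "spectral_norm (\<Delta> j) \<le> max (norm (A j *v x)) (norm (star (A j) *v x))"
      using that D(3)[of j] by (simp add: \<Delta>_def pal_idx_eq)
    then show ?thesis
      unfolding le_max_iff_disj by (auto intro!: power_mono spectral_norm_nonneg)
  qed
  then have "(\<Sum>j\<in>pal_idx m. (spectral_norm (\<Delta> j))\<^sup>2)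
      \<le> (\<Sum>j\<in>pal_idx m. max ((norm (A j *v x))\<^sup>2) ((norm (star (A j) *v x))\<^sup>2))"
    by (rule sum_mono)
  moreover have "(\<Sum>j\<le>m. (spectral_norm (\<Delta> j))\<^sup>2) = 2 * (\<Sum>j\<in>pal_idx m. (spectral_norm (\<Delta> j))\<^sup>2)
      + (if even m then (spectral_norm (\<Delta> (m div 2)))\<^sup>2 else 0)"
    by (rule sum_palindrome) (simp add: norm_eq)
  moreover have "(spectral_norm (\<Delta> (m div 2)))\<^sup>2 \<le> (norm (A (m div 2) *v x))\<^sup>2" if "even m"
    using that E(3) by (auto simp: \<Delta>_def intro!: power_mono spectral_norm_nonneg)
  ultimately have "(\<Sum>j\<le>m. (spectral_norm (\<Delta> j))\<^sup>2) \<le> perturbation_cost star m A x"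
    by (auto simp: perturbation_cost_def)
  with pal ker show ?thesis
    by (rule that)
qed

lemma delta0_pal_sq_le_cost:
  fixes A :: "nat \<Rightarrow> complex^'n^'n"
  assumes star: "star \<in> {ctranspose, transpose}"
    and A: "palindromic star m A" and x: "norm x = 1"
  shows "(delta0_pal star m A)\<^sup>2 \<le> perturbation_cost star m A x"
proof -
  let ?S = "{sqrt (\<Sum>j\<le>m. (spectral_norm (\<Delta> j))\<^sup>2) | \<Delta> :: nat \<Rightarrow> complex^'n^'n.
            palindromic star m \<Delta> \<and> (\<Inter>j\<le>m. mat_kernel (A j - \<Delta> j)) \<noteq> {0}}"
  obtain \<Delta> where \<Delta>: "palindromic star m \<Delta>" "\<And>j. j \<le> m \<Longrightarrow> \<Delta> j *v x = A j *v x"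
    "(\<Sum>j\<le>m. (spectral_norm (\<Delta> j))\<^sup>2) \<le> perturbation_cost star m A x"
    by (rule perturbation_cost_attained[OF assms]) blast
  let ?s = "sqrt (\<Sum>j\<le>m. (spectral_norm (\<Delta> j))\<^sup>2)"
  have "x \<in> (\<Inter>j\<le>m. mat_kernel (A j - \<Delta> j))"
    using \<Delta>(2) by (auto simp: mat_kernel_def matrix_vector_mult_diff_rdistrib)
  moreover have "x \<noteq> 0"
    using x by auto
  ultimately have inS: "?s \<in> ?S"
    using \<Delta>(1) by blast
  have nn: "0 \<le> s" if "s \<in> ?S" for s
    using that by (auto intro!: sum_nonneg)
  have "?S \<noteq> {}"
    using inS by (rule ex_in_conv[THEN iffD1, OF exI])
  then have "0 \<le> delta0_pal star m A"
    unfolding delta0_pal_def using nn by (rule cInf_greatest)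
  moreover have "delta0_pal star m A \<le> ?s"
    unfolding delta0_pal_def by (rule cInf_lower[OF inS bdd_belowI[OF nn]])
  ultimately have "(delta0_pal star m A)\<^sup>2 \<le> ?s\<^sup>2"
    by (intro power_mono)
  also have "\<dots> = (\<Sum>j\<le>m. (spectral_norm (\<Delta> j))\<^sup>2)"
    by (simp add: sum_nonneg)
  finally show ?thesis
    using \<Delta>(3) by simp
qed

lemma le_delta0_pal_sq:
  fixes A :: "nat \<Rightarrow> complex^'n^'n"
  assumes star: "star \<in> {ctranspose, transpose}"
    and A: "palindromic star m A" and c: "\<And>x. norm x = 1 \<Longrightarrow> c \<le> perturbation_cost star m A x"
  shows "c \<le> (delta0_pal star m A)\<^sup>2"
proof (cases "0 \<le> c")
  case True
  let ?S = "{sqrt (\<Sum>j\<le>m. (spectral_norm (\<Delta> j))\<^sup>2) | \<Delta> :: nat \<Rightarrow> complex^'n^'n.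
            palindromic star m \<Delta> \<and> (\<Inter>j\<le>m. mat_kernel (A j - \<Delta> j)) \<noteq> {0}}"
  have "(axis undefined 1 :: complex^'n) \<noteq> 0"
    by (simp add: axis_eq_0_iff)
  then have "(\<Inter>j\<le>m. mat_kernel (A j - A j)) \<noteq> {0}"
    by (auto simp: mat_kernel_def)
  with A have nonempty: "?S \<noteq> {}"
    by blast
  have "sqrt c \<le> s" if "s \<in> ?S" for s
  proof -
    obtain \<Delta> :: "nat \<Rightarrow> complex^'n^'n" where s: "s = sqrt (\<Sum>j\<le>m. (spectral_norm (\<Delta> j))\<^sup>2)"
      and \<Delta>: "palindromic star m \<Delta>" "(\<Inter>j\<le>m. mat_kernel (A j - \<Delta> j)) \<noteq> {0}"
      using \<open>s \<in> ?S\<close> by blast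
    moreover have "0 \<in> (\<Inter>j\<le>m. mat_kernel (A j - \<Delta> j))"
      by (simp add: mat_kernel_def)
    ultimately obtain y where y: "y \<noteq> 0" "y \<in> (\<Inter>j\<le>m. mat_kernel (A j - \<Delta> j))"
      by blast
    let ?x = "(1 / norm y) *\<^sub>R y"
    have "\<Delta> j *v ?x = A j *v ?x" if "j \<le> m" for j
    proof -
      have "\<Delta> j *v y = A j *v y"
        using y(2) that by (auto simp: mat_kernel_def matrix_vector_mult_diff_rdistrib)
      then show ?thesis
        using linear_cmul[OF matrix_vector_mul_linear] by metis
    qed
    then have "perturbation_cost star m A ?x \<le> (\<Sum>j\<le>m. (spectral_norm (\<Delta> j))\<^sup>2)"
      using y(1) by (intro perturbation_cost_le star A \<Delta>) auto
    moreover have "c \<le> perturbation_cost star m A ?x"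
      by (rule c) (use y(1) in simp)
    ultimately show ?thesis
      by (simp add: s)
  qed
  then have "sqrt c \<le> delta0_pal star m A"
    unfolding delta0_pal_def using nonempty by (intro cInf_greatest)
  then show ?thesis
    using True by (simp add: sqrt_le_D)
qed (use zero_le_power2[of "delta0_pal star m A"] in linarith)

section \<open>The parametrized Hermitian form\<close>

definition coefficient_excess :: "(complex^'n^'n \<Rightarrow> complex^'n^'n) \<Rightarrow> complex^'n^'n \<Rightarrow> complex^'n \<Rightarrow> real" where
  "coefficient_excess star M x = (norm (M *v x))\<^sup>2 - (norm (star M *v x))\<^sup>2"

lemma matrix_vector_mult_sum: "(\<Sum>j\<in>I. M j) *v x = (\<Sum>j\<in>I. M j *v x)"
  for M :: "'b \<Rightarrow> complex^'n^'m"
  by (induction I rule: infinite_finite_induct) (auto simp: matrix_vector_mult_add_rdistrib)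

lemma inner_gram: "x \<bullet> ((ctranspose M ** M) *v y) = (M *v x) \<bullet> (M *v y)"
  by (metis ctranspose_ctranspose inner_ctranspose matrix_vector_mul_assoc)

lemma inner_pal_f:
  "x \<bullet> (pal_f star m A \<gamma> *v y) =
    (\<Sum>j\<in>pal_idx m. (1 - \<gamma> j) * ((star (A j) *v x) \<bullet> (star (A j) *v y)) + \<gamma> j * ((A j *v x) \<bullet> (A j *v y)))
    + (if even m then (A (m div 2) *v x) \<bullet> (A (m div 2) *v y) / 2 else 0)"
  unfolding pal_f_def
  by (simp add: matrix_vector_mult_add_rdistrib matrix_vector_mult_sum matrix_vector_mult_diff_rdistrib
      scaleR_matrix_vector inner_add_right inner_diff_right inner_sum_right inner_gram algebra_simps)

lemma pal_f_self_adjoint: "x \<bullet> (pal_f star m A \<gamma> *v y) = (pal_f star m A \<gamma> *v x) \<bullet> y"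
  by (subst (2) inner_commute) (simp add: inner_pal_f inner_commute)

lemma pal_f_form:
  "x \<bullet> (pal_f star m A \<gamma> *v x) =
    (\<Sum>j\<in>pal_idx m. (norm (star (A j) *v x))\<^sup>2 + \<gamma> j * coefficient_excess star (A j) x)
    + (if even m then (norm (A (m div 2) *v x))\<^sup>2 / 2 else 0)"
  by (simp add: inner_pal_f coefficient_excess_def power2_norm_eq_inner algebra_simps)

lemma pal_f_form_diff:
  "x \<bullet> (pal_f star m A \<gamma>' *v x) - x \<bullet> (pal_f star m A \<gamma> *v x)
    = (\<Sum>j\<in>pal_idx m. (\<gamma>' j - \<gamma> j) * coefficient_excess star (A j) x)"
  by (simp add: pal_f_form algebra_simps flip: sum_subtractf)

lemma coefficient_excess_scaleR:
  fixes x :: "complex^'n"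
  shows "coefficient_excess star M (c *\<^sub>R x) = c\<^sup>2 * coefficient_excess star M x"
proof -
  have "N *v (c *\<^sub>R x) = c *\<^sub>R (N *v x)" for N :: "complex^'n^'n"
    by (rule linear_cmul[OF matrix_vector_mul_linear])
  then show ?thesis
    by (simp add: coefficient_excess_def power_mult_distrib algebra_simps)
qed

lemma coefficient_excess_scale: "coefficient_excess star M (c *s x) = (cmod c)\<^sup>2 * coefficient_excess star M x"
  by (simp add: coefficient_excess_def vector_scalar_commute norm_vector_scale power_mult_distrib algebra_simps)

lemma continuous_on_coefficient_excess: "continuous_on S (coefficient_excess star M)"
  unfolding coefficient_excess_def
  by (intro continuous_intros linear_continuous_on) (simp_all add: linear_linear)

lemma coefficient_excess_bound:
  fixes x :: "complex^'n"
  assumes "norm x = 1"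
  shows "\<bar>coefficient_excess star M x\<bar> \<le> (spectral_norm M)\<^sup>2 + (spectral_norm (star M))\<^sup>2"
proof -
  have "(norm (N *v x))\<^sup>2 \<le> (spectral_norm N)\<^sup>2" for N :: "complex^'n^'n"
    using norm_matrix_vector_le[of N x] assms by (simp add: power_mono)
  from this[of M] this[of "star M"] show ?thesis
    unfolding coefficient_excess_def
    using zero_le_power2[of "norm (M *v x)"] zero_le_power2[of "norm (star M *v x)"] by linarith
qed

lemmas pal_f_lambda_min = lambda_min_self_adjoint[OF pal_f_self_adjoint]

lemma pal_cube_bounds:
  assumes "\<gamma> \<in> pal_cube m" "j \<in> pal_idx m"
  shows "0 \<le> \<gamma> j" "\<gamma> j \<le> 1"
  using PiE_mem[of \<gamma> "pal_idx m" "\<lambda>_. {0..1}" j] assms by (simp_all add: pal_cube_def)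

text \<open>A convex combination of \<open>norm (A j *v x)\<^sup>2\<close> and \<open>norm (star (A j) *v x)\<^sup>2\<close> is at most their
  maximum, and equal to it if the weight that is not on the larger one vanishes.\<close>

lemma pal_f_form_le_cost:
  assumes "\<gamma> \<in> pal_cube m"
  shows "2 * (x \<bullet> (pal_f star m A \<gamma> *v x)) \<le> perturbation_cost star m A x"
proof -
  have "(norm (star (A j) *v x))\<^sup>2 + \<gamma> j * coefficient_excess star (A j) x
      \<le> max ((norm (A j *v x))\<^sup>2) ((norm (star (A j) *v x))\<^sup>2)" if "j \<in> pal_idx m" for j
  proof -
    have "0 \<le> \<gamma> j" "\<gamma> j \<le> 1"
      using pal_cube_bounds[OF assms that] .
    moreover have "b + c * (a - b) \<le> max a b" if "0 \<le> c" "c \<le> 1" for a b c :: real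
      using convex_bound_le[of a "max a b" b c "1 - c"] that by (simp add: algebra_simps)
    ultimately show ?thesis
      by (simp add: coefficient_excess_def)
  qed
  then show ?thesis
    unfolding pal_f_form perturbation_cost_def by (auto intro!: sum_mono)
qed

lemma pal_f_form_eq_cost:
  assumes "\<gamma> \<in> pal_cube m"
    and "\<And>j. j \<in> pal_idx m \<Longrightarrow> \<gamma> j < 1 \<Longrightarrow> coefficient_excess star (A j) x \<le> 0"
    and "\<And>j. j \<in> pal_idx m \<Longrightarrow> 0 < \<gamma> j \<Longrightarrow> 0 \<le> coefficient_excess star (A j) x"
  shows "perturbation_cost star m A x = 2 * (x \<bullet> (pal_f star m A \<gamma> *v x))"
proof -
  have "max ((norm (A j *v x))\<^sup>2) ((norm (star (A j) *v x))\<^sup>2)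
      = (norm (star (A j) *v x))\<^sup>2 + \<gamma> j * coefficient_excess star (A j) x" if "j \<in> pal_idx m" for j
  proof -
    have "0 \<le> \<gamma> j" "\<gamma> j \<le> 1"
      using pal_cube_bounds[OF assms(1) that] .
    then consider "\<gamma> j = 0" | "\<gamma> j = 1" | "0 < \<gamma> j" "\<gamma> j < 1"
      by linarith
    then show ?thesis
      by cases (use assms(2,3)[OF that] in \<open>auto simp: coefficient_excess_def\<close>)
  qed
  then show ?thesis
    unfolding pal_f_form perturbation_cost_def by (simp cong: sum.cong)
qed

section \<open>The optimal parameters\<close>

lemma pal_cube_nonempty: "pal_cube m \<noteq> {}"
  by (auto simp: pal_cube_def PiE_eq_empty_iff)

text \<open>As functions of type \<^typ>\<open>nat \<Rightarrow> real\<close>, the members of the cube have the constant value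
  \<^const>\<open>undefined\<close> at the remaining indices, so the cube is a product of compact sets over all of
  \<^typ>\<open>nat\<close>.\<close>

lemma compact_pal_cube: "compact (pal_cube m)"
proof -
  let ?C = "\<lambda>j. if j \<in> pal_idx m then {0..1} else {undefined :: real}"
  have "pal_cube m = PiE UNIV ?C"
    by (auto simp: pal_cube_def PiE_def Pi_def extensional_def split: if_splits)
  moreover have "compactin (product_topology (\<lambda>_. euclidean) UNIV) (PiE UNIV ?C)"
    by (simp add: compactin_PiE)
  ultimately show ?thesis
    by (simp add: euclidean_product_topology)
qed

text \<open>The form of \<open>f(\<gamma>')\<close> is tested at a minimizer for \<open>\<gamma>\<close>.\<close>

lemma lambda_min_pal_f_lipschitz:
  "lambda_min (pal_f star m A \<gamma>') - lambda_min (pal_f star m A \<gamma>)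
    \<le> (\<Sum>j\<in>pal_idx m. \<bar>\<gamma>' j - \<gamma> j\<bar> * ((spectral_norm (A j))\<^sup>2 + (spectral_norm (star (A j)))\<^sup>2))"
proof -
  obtain v where v: "norm v = 1" "pal_f star m A \<gamma> *v v = lambda_min (pal_f star m A \<gamma>) *\<^sub>R v"
    using pal_f_lambda_min(1) by blast
  then have "lambda_min (pal_f star m A \<gamma>) = v \<bullet> (pal_f star m A \<gamma> *v v)"
    by (simp flip: power2_norm_eq_inner)
  moreover have "lambda_min (pal_f star m A \<gamma>') \<le> v \<bullet> (pal_f star m A \<gamma>' *v v)"
    using pal_f_lambda_min(2)[of star m A \<gamma>' v] v by simp
  ultimately have "lambda_min (pal_f star m A \<gamma>') - lambda_min (pal_f star m A \<gamma>)
      \<le> v \<bullet> (pal_f star m A \<gamma>' *v v) - v \<bullet> (pal_f star m A \<gamma> *v v)"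
    by simp
  also have "\<dots> \<le> (\<Sum>j\<in>pal_idx m. \<bar>\<gamma>' j - \<gamma> j\<bar> * ((spectral_norm (A j))\<^sup>2 + (spectral_norm (star (A j)))\<^sup>2))"
    unfolding pal_f_form_diff
  proof (rule sum_mono)
    fix j
    have "(\<gamma>' j - \<gamma> j) * coefficient_excess star (A j) v \<le> \<bar>\<gamma>' j - \<gamma> j\<bar> * \<bar>coefficient_excess star (A j) v\<bar>"
      by (simp flip: abs_mult)
    also have "\<dots> \<le> \<bar>\<gamma>' j - \<gamma> j\<bar> * ((spectral_norm (A j))\<^sup>2 + (spectral_norm (star (A j)))\<^sup>2)"
      by (intro mult_left_mono coefficient_excess_bound v abs_ge_zero)
    finally show "(\<gamma>' j - \<gamma> j) * coefficient_excess star (A j) v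
        \<le> \<bar>\<gamma>' j - \<gamma> j\<bar> * ((spectral_norm (A j))\<^sup>2 + (spectral_norm (star (A j)))\<^sup>2)" .
  qed
  finally show ?thesis .
qed

lemma continuous_on_lambda_min_pal_f: "continuous_on S (\<lambda>\<gamma>. lambda_min (pal_f star m A \<gamma>))"
  unfolding continuous_on_def
proof
  fix \<gamma> assume "\<gamma> \<in> S"
  let ?B = "\<lambda>\<gamma>'. \<Sum>j\<in>pal_idx m. \<bar>\<gamma>' j - \<gamma> j\<bar> * ((spectral_norm (A j))\<^sup>2 + (spectral_norm (star (A j)))\<^sup>2)"
  have coord: "((\<lambda>\<gamma>'. \<gamma>' j) \<longlongrightarrow> \<gamma> j) (at \<gamma> within S)" for j :: nat
    using continuous_on_subset[OF continuous_on_product_coordinates[of j] subset_UNIV, of S] \<open>\<gamma> \<in> S\<close>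
    unfolding continuous_on_def by blast
  have "(?B \<longlongrightarrow> (\<Sum>j\<in>pal_idx m. \<bar>\<gamma> j - \<gamma> j\<bar> * ((spectral_norm (A j))\<^sup>2 + (spectral_norm (star (A j)))\<^sup>2)))
      (at \<gamma> within S)"
    by (intro tendsto_intros coord)
  then have B0: "(?B \<longlongrightarrow> 0) (at \<gamma> within S)"
    by simp
  have "\<bar>lambda_min (pal_f star m A \<gamma>') - lambda_min (pal_f star m A \<gamma>)\<bar> \<le> ?B \<gamma>'" for \<gamma>'
    using lambda_min_pal_f_lipschitz[of star m A \<gamma>' \<gamma>] lambda_min_pal_f_lipschitz[of star m A \<gamma> \<gamma>']
    by (simp add: abs_le_iff abs_minus_commute)
  then have "\<forall>\<^sub>F \<gamma>' in at \<gamma> within S.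
      norm (lambda_min (pal_f star m A \<gamma>') - lambda_min (pal_f star m A \<gamma>)) \<le> ?B \<gamma>'"
    unfolding real_norm_def by (intro always_eventually allI)
  then have "((\<lambda>\<gamma>'. lambda_min (pal_f star m A \<gamma>') - lambda_min (pal_f star m A \<gamma>)) \<longlongrightarrow> 0) (at \<gamma> within S)"
    using B0 by (rule Lim_null_comparison)
  then show "((\<lambda>\<gamma>'. lambda_min (pal_f star m A \<gamma>')) \<longlongrightarrow> lambda_min (pal_f star m A \<gamma>)) (at \<gamma> within S)"
    by (rule LIM_zero_cancel)
qed

lemma lambda_hat_attained:
  shows lambda_hat_exists: "\<exists>\<gamma>\<in>pal_cube m. lambda_min (pal_f star m A \<gamma>) = lambda_hat star m A"
    and lambda_min_le_lambda_hat:
      "\<gamma> \<in> pal_cube m \<Longrightarrow> lambda_min (pal_f star m A \<gamma>) \<le> lambda_hat star m A"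
proof -
  let ?g = "\<lambda>\<gamma>. lambda_min (pal_f star m A \<gamma>)"
  obtain \<gamma>0 where \<gamma>0: "\<gamma>0 \<in> pal_cube m" "\<And>\<gamma>. \<gamma> \<in> pal_cube m \<Longrightarrow> ?g \<gamma> \<le> ?g \<gamma>0"
    using continuous_attains_sup[OF compact_pal_cube pal_cube_nonempty continuous_on_lambda_min_pal_f]
    by blast
  have hat: "lambda_hat star m A = ?g \<gamma>0"
    unfolding lambda_hat_def by (rule cSup_eq_maximum) (use \<gamma>0 in auto)
  show "\<exists>\<gamma>\<in>pal_cube m. ?g \<gamma> = lambda_hat star m A"
    using hat[symmetric] \<gamma>0(1) by (rule bexI)
  show "?g \<gamma> \<le> lambda_hat star m A" if "\<gamma> \<in> pal_cube m"
    unfolding hat using that by (rule \<gamma>0(2))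
qed

text \<open>If \<open>\<gamma>\<close> is optimal, then moving one coordinate within the cube does not raise the smallest
  eigenvalue. The derivative in that direction is a value of \<^const>\<open>coefficient_excess\<close> on the
  eigenspace, which therefore has the corresponding sign at some eigenvector.\<close>

lemma optimal_coordinate_direction:
  fixes A :: "nat \<Rightarrow> complex^'n^'n" and s :: real
  assumes \<gamma>: "\<gamma> \<in> pal_cube m" and opt: "lambda_min (pal_f star m A \<gamma>) = lambda_hat star m A"
    and j: "j \<in> pal_idx m" and e: "0 < e" "\<And>t. 0 < t \<Longrightarrow> t \<le> e \<Longrightarrow> \<gamma> j + t * s \<in> {0..1}"
  shows "\<exists>x. norm x = 1 \<and> pal_f star m A \<gamma> *v x = lambda_hat star m A *\<^sub>R x
    \<and> s * coefficient_excess star (A j) x \<le> 0"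
proof -
  let ?L = "lambda_hat star m A"
  let ?F = "\<lambda>x. x \<bullet> (pal_f star m A \<gamma> *v x)" and ?K = "\<lambda>x. s * coefficient_excess star (A j) x"
  have "\<exists>x\<in>sphere 0 1. ?F x = ?L \<and> ?K x \<le> 0"
  proof (rule minimizer_of_unimproved_minimum[OF _ _ _ e(1)])
    show "compact (sphere (0::complex^'n) 1)"
      by simp
    show "continuous_on (sphere 0 1) ?F"
      by (intro continuous_intros linear_continuous_on) (simp add: linear_linear)
    show "continuous_on (sphere 0 1) ?K"
      by (intro continuous_intros continuous_on_coefficient_excess)
    show "?L \<le> ?F x" if "x \<in> sphere 0 1" for x
      using pal_f_lambda_min(2)[of star m A \<gamma> x] that by (simp add: opt)
    show "\<exists>x\<in>sphere 0 1. ?F x + t * ?K x \<le> ?L" if t: "0 < t" "t \<le> e" for t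
    proof -
      define \<gamma>' where "\<gamma>' = \<gamma>(j := \<gamma> j + t * s)"
      have \<gamma>': "\<gamma>' \<in> pal_cube m"
        using \<gamma> j e(2)[OF t] by (auto simp: \<gamma>'_def pal_cube_def PiE_iff extensional_def)
      obtain x where x: "norm x = 1" "pal_f star m A \<gamma>' *v x = lambda_min (pal_f star m A \<gamma>') *\<^sub>R x"
        using pal_f_lambda_min(1) by blast
      have "x \<bullet> (pal_f star m A \<gamma>' *v x) - ?F x = (\<Sum>i\<in>pal_idx m. if i = j then t * ?K x else 0)"
        unfolding pal_f_form_diff by (rule sum.cong) (auto simp: \<gamma>'_def)
      then have "?F x + t * ?K x = x \<bullet> (pal_f star m A \<gamma>' *v x)"
        using j by simp
      also have "\<dots> = lambda_min (pal_f star m A \<gamma>')"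
        using x by (simp flip: power2_norm_eq_inner)
      also have "\<dots> \<le> ?L"
        by (rule lambda_min_le_lambda_hat[OF \<gamma>'])
      finally show ?thesis
        using x(1) by auto
    qed
  qed
  then obtain x where x: "norm x = 1" "?F x = ?L" "?K x \<le> 0"
    by auto
  then have "pal_f star m A \<gamma> *v x = ?L *\<^sub>R x"
    using pal_f_lambda_min(3)[of x star m A \<gamma>] by (simp add: opt)
  with x show ?thesis
    by (intro exI[of _ x] conjI)
qed

lemma optimal_increase:
  assumes "\<gamma> \<in> pal_cube m" "lambda_min (pal_f star m A \<gamma>) = lambda_hat star m A"
    and "j \<in> pal_idx m" "\<gamma> j < 1"
  shows "\<exists>x. norm x = 1 \<and> pal_f star m A \<gamma> *v x = lambda_hat star m A *\<^sub>R x
    \<and> coefficient_excess star (A j) x \<le> 0"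
proof -
  have "\<exists>x. norm x = 1 \<and> pal_f star m A \<gamma> *v x = lambda_hat star m A *\<^sub>R x
    \<and> 1 * coefficient_excess star (A j) x \<le> 0"
    by (rule optimal_coordinate_direction[OF assms(1-3), of "1 - \<gamma> j"])
      (use assms(4) pal_cube_bounds[OF assms(1,3)] in simp_all)
  then show ?thesis
    by simp
qed

lemma optimal_decrease:
  assumes "\<gamma> \<in> pal_cube m" "lambda_min (pal_f star m A \<gamma>) = lambda_hat star m A"
    and "j \<in> pal_idx m" "0 < \<gamma> j"
  shows "\<exists>x. norm x = 1 \<and> pal_f star m A \<gamma> *v x = lambda_hat star m A *\<^sub>R x
    \<and> 0 \<le> coefficient_excess star (A j) x"
proof -
  have "\<exists>x. norm x = 1 \<and> pal_f star m A \<gamma> *v x = lambda_hat star m A *\<^sub>R x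
    \<and> (- 1) * coefficient_excess star (A j) x \<le> 0"
    by (rule optimal_coordinate_direction[OF assms(1-3), of "\<gamma> j"])
      (use assms(4) pal_cube_bounds[OF assms(1,3)] in simp_all)
  then show ?thesis
    by simp
qed

section \<open>Lower bound and equality\<close>

lemma delta0_pal_lower_bound:
  fixes A :: "nat \<Rightarrow> complex^'n^'n"
  assumes star: "star \<in> {ctranspose, transpose}" and A: "palindromic star m A"
  shows "2 * lambda_hat star m A \<le> (delta0_pal star m A)\<^sup>2"
proof (rule le_delta0_pal_sq[OF assms])
  fix x :: "complex^'n" assume x: "norm x = 1"
  obtain \<gamma> where \<gamma>: "\<gamma> \<in> pal_cube m" "lambda_min (pal_f star m A \<gamma>) = lambda_hat star m A"
    using lambda_hat_exists by blast
  have "lambda_hat star m A \<le> x \<bullet> (pal_f star m A \<gamma> *v x)"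
    using pal_f_lambda_min(2)[of star m A \<gamma> x] x \<gamma>(2) by simp
  then show "2 * lambda_hat star m A \<le> perturbation_cost star m A x"
    using pal_f_form_le_cost[OF \<gamma>(1), of x star A] by linarith
qed

text \<open>A unit eigenvector at which all sign conditions hold together is a saddle point with \<open>\<gamma>\<close>: no
  other parameter gives a larger value of the form there.\<close>

lemma delta0_pal_eq_if_saddle:
  fixes A :: "nat \<Rightarrow> complex^'n^'n"
  assumes star: "star \<in> {ctranspose, transpose}" and A: "palindromic star m A"
    and \<gamma>: "\<gamma> \<in> pal_cube m"
    and x: "norm x = 1" "pal_f star m A \<gamma> *v x = lambda_hat star m A *\<^sub>R x"
    and "\<And>j. j \<in> pal_idx m \<Longrightarrow> \<gamma> j < 1 \<Longrightarrow> coefficient_excess star (A j) x \<le> 0"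
    and "\<And>j. j \<in> pal_idx m \<Longrightarrow> 0 < \<gamma> j \<Longrightarrow> 0 \<le> coefficient_excess star (A j) x"
  shows "(delta0_pal star m A)\<^sup>2 = 2 * lambda_hat star m A"
proof (rule antisym)
  have "(delta0_pal star m A)\<^sup>2 \<le> perturbation_cost star m A x"
    by (rule delta0_pal_sq_le_cost[OF star A x(1)])
  also have "\<dots> = 2 * (x \<bullet> (pal_f star m A \<gamma> *v x))"
    using assms(6,7) by (rule pal_f_form_eq_cost[OF \<gamma>])
  also have "\<dots> = 2 * lambda_hat star m A"
    using x by (simp flip: power2_norm_eq_inner)
  finally show "(delta0_pal star m A)\<^sup>2 \<le> 2 * lambda_hat star m A" .
qed (rule delta0_pal_lower_bound[OF star A])

text \<open>With one parameter, the two sign conditions at an interior optimum are met by two eigenvectors,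
  and by a common one between them.\<close>

lemma delta0_pal_eq_if_degree_le_2:
  fixes A :: "nat \<Rightarrow> complex^'n^'n"
  assumes star: "star \<in> {ctranspose, transpose}" and A: "palindromic star m A" and m: "m \<le> 2"
  shows "(delta0_pal star m A)\<^sup>2 = 2 * lambda_hat star m A"
proof -
  obtain \<gamma> where \<gamma>: "\<gamma> \<in> pal_cube m" and opt: "lambda_min (pal_f star m A \<gamma>) = lambda_hat star m A"
    using lambda_hat_exists by blast
  let ?P = "\<lambda>x. norm x = 1 \<and> pal_f star m A \<gamma> *v x = lambda_hat star m A *\<^sub>R x"
  let ?k = "coefficient_excess star (A 0)"
  have idx: "j = 0 \<and> 0 \<in> pal_idx m" if "j \<in> pal_idx m" for j
    using that m by (auto simp: pal_idx_eq)
  have "\<exists>x. ?P x \<and> (0 \<in> pal_idx m \<longrightarrow> (\<gamma> 0 < 1 \<longrightarrow> ?k x \<le> 0) \<and> (0 < \<gamma> 0 \<longrightarrow> 0 \<le> ?k x))"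
  proof (cases "0 \<in> pal_idx m")
    case False
    then show ?thesis
      using pal_f_lambda_min(1)[of star m A \<gamma>] by (auto simp: opt)
  next
    case True
    consider "\<not> \<gamma> 0 < 1" | "\<not> 0 < \<gamma> 0" | "0 < \<gamma> 0" "\<gamma> 0 < 1"
      by blast
    then show ?thesis
    proof cases
      case 1
      then show ?thesis
        using optimal_decrease[OF \<gamma> opt True] by auto
    next
      case 2
      then show ?thesis
        using optimal_increase[OF \<gamma> opt True] by auto
    next
      case 3
      let ?V = "{x. pal_f star m A \<gamma> *v x = lambda_hat star m A *\<^sub>R x}"
      have lin: "linear (\<lambda>x. pal_f star m A \<gamma> *v x)"
        by (rule matrix_vector_mul_linear)
      have V: "subspace ?V"
        by (rule subspaceI) (simp_all add: linear_0[OF lin] linear_add[OF lin] linear_cmul[OF lin] scaleR_add_right)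
      obtain x where x: "?P x" "?k x \<le> 0"
        using optimal_increase[OF \<gamma> opt True 3(2)] by blast
      obtain y where y: "?P y" "0 \<le> ?k y"
        using optimal_decrease[OF \<gamma> opt True 3(1)] by blast
      have "\<exists>z\<in>?V. norm z = 1 \<and> ?k z = 0"
        by (rule quadratic_zero_in_subspace[OF V, of x _ y])
          (use x y in \<open>auto simp: coefficient_excess_scaleR continuous_on_coefficient_excess\<close>)
      then show ?thesis
        by auto
    qed
  qed
  then obtain x where x: "norm x = 1" "pal_f star m A \<gamma> *v x = lambda_hat star m A *\<^sub>R x"
    "0 \<in> pal_idx m \<Longrightarrow> \<gamma> 0 < 1 \<Longrightarrow> ?k x \<le> 0" "0 \<in> pal_idx m \<Longrightarrow> 0 < \<gamma> 0 \<Longrightarrow> 0 \<le> ?k x"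
    by blast
  show ?thesis
    by (rule delta0_pal_eq_if_saddle[OF star A \<gamma> x(1,2)]) (use x(3,4) idx in metis)+
qed

text \<open>If the eigenspace is a complex line, then each sign found at one of its unit vectors holds at
  all of them.\<close>

lemma delta0_pal_eq_if_simple:
  fixes A :: "nat \<Rightarrow> complex^'n^'n"
  assumes star: "star \<in> {ctranspose, transpose}" and A: "palindromic star m A"
    and \<gamma>: "\<gamma> \<in> pal_cube m" and opt: "lambda_min (pal_f star m A \<gamma>) = lambda_hat star m A"
    and simple: "simple_eigenvalue (pal_f star m A \<gamma>) (complex_of_real (lambda_hat star m A))"
  shows "(delta0_pal star m A)\<^sup>2 = 2 * lambda_hat star m A"
proof -
  let ?H = "pal_f star m A \<gamma>" and ?L = "lambda_hat star m A"
  obtain x where x: "norm x = 1" "?H *v x = ?L *\<^sub>R x"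
    using pal_f_lambda_min(1)[of star m A \<gamma>] by (auto simp: opt)
  have same: "coefficient_excess star M y = coefficient_excess star M x"
    if y: "norm y = 1" "?H *v y = ?L *\<^sub>R y" for y M
  proof -
    have "\<exists>c. y = c *s x"
      by (rule simple_eigenvalue_eigenvectors_parallel[OF simple]) (use x y in \<open>auto simp: of_real_scale\<close>)
    then obtain c where c: "y = c *s x" ..
    then have "cmod c = 1"
      using x y by (simp add: norm_vector_scale)
    with c show ?thesis
      by (simp add: coefficient_excess_scale)
  qed
  show ?thesis
  proof (rule delta0_pal_eq_if_saddle[OF star A \<gamma> x])
    fix j assume j: "j \<in> pal_idx m"
    show "coefficient_excess star (A j) x \<le> 0" if "\<gamma> j < 1"
      using optimal_increase[OF \<gamma> opt j that] same by metis
    show "0 \<le> coefficient_excess star (A j) x" if "0 < \<gamma> j"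
      using optimal_decrease[OF \<gamma> opt j that] same by metis
  qed
qed

theorem theorem4p2:
  fixes star :: "complex^'n^'n \<Rightarrow> complex^'n^'n"
    and m :: nat
    and A :: "nat \<Rightarrow> complex^'n^'n"
  assumes "star \<in> {ctranspose, transpose}"
    and "palindromic star m A"
  shows "(\<exists>\<gamma>\<in>pal_cube m. lambda_min (pal_f star m A \<gamma>) = lambda_hat star m A)
    \<and> (delta0_pal star m A)\<^sup>2 \<ge> 2 * lambda_hat star m A
    \<and> (m \<le> 2 \<longrightarrow> (delta0_pal star m A)\<^sup>2 = 2 * lambda_hat star m A)
    \<and> (\<forall>\<gamma>\<in>pal_cube m.
          lambda_min (pal_f star m A \<gamma>) = lambda_hat star m A
          \<and> simple_eigenvalue (pal_f star m A \<gamma>) (complex_of_real (lambda_hat star m A))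
          \<longrightarrow> (delta0_pal star m A)\<^sup>2 = 2 * lambda_hat star m A)"
  using lambda_hat_exists delta0_pal_lower_bound[OF assms] delta0_pal_eq_if_degree_le_2[OF assms]
    delta0_pal_eq_if_simple[OF assms] by blast

end
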